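(* Let $\mathcal{T}=(\mathbb{T},V,\xi)$ be a strict topological theory with $T1=1$. The representable functor $\mathcal{T}\text{-}\mathrm{Frm}(-,V)\colon(\mathcal{T}\text{-}\mathrm{Frm})^{\mathrm{op}}\to\mathrm{Ord}$ lifts (along the forgetful functor $\mathcal{T}\text{-}\mathrm{Cat}\to\mathrm{Ord}$) to a functor $\mathrm{pt}\colon(\mathcal{T}\text{-}\mathrm{Frm})^{\mathrm{op}}\to\mathcal{T}\text{-}\mathrm{Cat}$.
   Context: **Quantales and theories.** $V=(V,\bigvee,\otimes,k)$ is a commutative quantale: a complete lattice with a commutative associative operation $\otimes$ with unit $k$, preserving suprema in each variable; $\hom$ is defined by $x\otimes y\le z\iff x\le\hom(y,z)$. A strict topological theory $\mathcal{T}=(\mathbb{T},V,\xi)$ consists of a monad $\mathbb{T}=(T,m,e)$ on $\mathrm{Set}$, a commutative quantale $V$ and a map $\xi\colon TV\to V$ such that: (a) $T$ sends pullbacks to weak pullbacks and every naturality square of $m$ is a weak pullback; (b) $(V,\xi)$ is an Eilenberg–Moore $\mathbb{T}$-algebra, and $\otimes\colon V\times V\to V$ and $k\colon 1\to V$ are $\mathbb{T}$-homomorphisms, i.e. $\xi(T(\otimes)(w))=\xi(T\pi_1(w))\otimes\xi(T\pi_2(w))$ for $w\in T(V\times V)$ and $\xi(T(k)(t))=k$ for $t\in T1$; (c) the maps $\xi_X\colon V^X\to V^{TX}$, $\varphi\mapsto\xi\cdot T\varphi$ (on sets of functions, pointwise order) are monotone and natural: for $f\colon X\to Y$ and $\varphi\colon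 X\to V$, with $(P_Vf)(\varphi)(y)=\bigvee_{f(x)=y}\varphi(x)$, one has $\xi_Y(P_Vf(\varphi))=P_V(Tf)(\xi_X(\varphi))$. Here $T1=1$ means that $T$ of a one-element set is a one-element set. **Matrices.** A $V$-matrix $r\colon X\to Y$ is a map $r\colon Y\times X\to V$; matrices are ordered pointwise. Put $T_\xi r(\mathfrak{y},\mathfrak{x})=\bigvee\{\xi(Tr(w))\mid w\in T(Y\times X),T\pi_1(w)=\mathfrak{y},T\pi_2(w)=\mathfrak{x}\}$. **$\mathcal{T}$-graphs, categories, functors.** A $\mathcal{T}$-graph $(X,a)$ is a set with $a\colon TX\times X\to V$ such that $k\le a(e_X(x),x)$ for all $x$; it is a $\mathcal{T}$-category if also $T_\xi a(\mathfrak{X},\mathfrak{y})\otimes a(\mathfrak{y},x)\le a(m_X(\mathfrak{X}),x)$ for all $\mathfrak{X}\in TTX$, $\mathfrak{y}\in TX$, $x\in X$. A $\mathcal{T}$-graph morphism ($\mathcal{T}$-functor, between $\mathcal{T}$-categories) $f\colon(X,a)\to(Y,b)$ is a map with $a(\mathfrak{x},x)\le b(Tf(\mathfrak{x}),f(x))$. $\mathcal{T}\text{-}\mathrm{Cat}$ is the category of $\mathcal{T}$-categories and $\mathcal{T}$-functors. The underlying $V$-graph of $(X,a)$ is $X$ with $X(x',x)=a(e_X(x'),x)$. The forgetful functor $\mathcal{T}\text{-}\mathrm{Cat}\to\mathrm{Ord}$ ($\mathrm{Ord}$: preordered sets and monotone maps) sends $(X,a)$ to $X$ with $x'\le x\iff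 k\le a(e_X(x'),x)$. A $\mathbb{T}$-algebra $(I,\alpha)$ is viewed as a $\mathcal{T}$-category with structure $(\mathfrak{i},i)\mapsto k$ if $\alpha(\mathfrak{i})=i$, $\bot$ otherwise. $V$ is a $\mathcal{T}$-category with structure $(\mathfrak{v},v)\mapsto\hom(\xi(\mathfrak{v}),v)$. **$V$-categorical notions.** For $V$-categories (hom-objects $A(x,y)\in V$), a $V$-distributor $1\to A$ is a map $\varphi\colon A\to V$ with $A(x,y)\otimes\varphi(y)\le\varphi(x)$; $PA$ is the $V$-category of these with $PA(\varphi,\varphi')=\bigwedge_x\hom(\varphi(x),\varphi'(x))$. A $V$-distributor $I\to1$ is a map $\varphi\colon I\to V$ with $\varphi(i)\otimes I(i,j)\le\varphi(j)$. $\sup_A\varphi$ is an object with $A(\sup_A\varphi,y)=\bigwedge_x\hom(\varphi(x),A(x,y))$. For $\psi\colon1\to I$ and a $V$-functor $h\colon I\to A$, the colimit $c$ satisfies $A(c,y)=\bigwedge_i\hom(\psi(i),A(h(i),y))$; for $\varphi\colon I\to1$, $\lim(\varphi,h)$ satisfies $A(y,\lim(\varphi,h))=\bigwedge_i\hom(\varphi(i),A(y,h(i)))$. The tensor $v\otimes x$ satisfies $A(v\otimes x,y)=\hom(v,A(x,y))$. As usual, such objects are determined up to isomorphism. Complete means having all weighted limits (hence all weighted colimits). **$\mathcal{T}$-frames.** Let $A$ be a $\mathcal{T}$-graph whose underlying $V$-graph is a $V$-category with tensors (also denoted $A$). A $\mathcal{T}$-weighted diagram in $A$ is a set $I$ with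 a $\mathbb{T}$-algebra structure and a $V$-category structure, a $V$-functor $h\colon I\to A$ and a $V$-distributor $\psi\colon 1\to I$ such that the map $I\to A$, $i\mapsto\psi(i)\otimes h(i)$ is a $\mathcal{T}$-graph morphism; its colimit is a $\mathcal{T}$-weighted colimit. A $V$-distributor $\varphi\colon1\to A$ is $\mathcal{T}$-generated if $\varphi(x)=\bigvee_iA(x,h(i))\otimes\psi(i)$ for such $h,\psi$. A $\mathcal{T}$-frame is a $\mathcal{T}$-graph $A$ whose underlying $V$-graph is a complete $V$-category such that for any $V$-category $I$, $V$-distributor $\varphi\colon I\to1$ and $V$-functor $h\colon I\to PA$ with all $h(i)$ $\mathcal{T}$-generated: if $\lim(\varphi,h)$ is $\mathcal{T}$-generated then $\sup_A(\lim(\varphi,h))=\lim(\varphi,\sup_A\cdot h)$. A $V$-functor $f\colon A\to B$ is $\mathcal{T}$-compatible if for each $\mathbb{T}$-algebra $I$ and $\mathcal{T}$-graph morphism $h\colon I\to A$, $f\cdot h$ is a $\mathcal{T}$-graph morphism. A $\mathcal{T}$-frame homomorphism is a $\mathcal{T}$-compatible $V$-functor between the underlying $V$-categories preserving weighted limits and $\mathcal{T}$-weighted colimits. These form the locally ordered category $\mathcal{T}\text{-}\mathrm{Frm}$. $V$, with the $\mathcal{T}$-structure above, is a $\mathcal{T}$-frame. $\mathcal{T}\text{-}\mathrm{Frm}(A,V)$ is ordered pointwise, and $\mathcal{T}\text{-}\mathrm{Frm}(f,V)$ is precomposition with $f$. *)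

theory Defs
  imports Complex_Main "HOL-Library.FuncSet"
begin

section \<open>Commutative quantales\<close>

text \<open>The operation is written \<open>*\<close> and its unit \<open>1\<close>; \<open>qhom y z\<close> is \<open>hom(y,z)\<close>.\<close>

class comm_quantale = complete_lattice + comm_monoid_mult +
  assumes mult_Sup: "x * Sup A = Sup ((*) x ` A)"

definition qhom :: "'v::comm_quantale \<Rightarrow> 'v \<Rightarrow> 'v" where
  "qhom y z = Sup {x. x * y \<le> z}"

lemma qmult_mono:
  fixes x :: "'v::comm_quantale"
  assumes "y \<le> y'" shows "x * y \<le> x * y'"
proof -
  have "x * y' = x * Sup {y, y'}" using assms by (simp add: sup_absorb2)
  also have "\<dots> = Sup ((*) x ` {y, y'})" by (rule mult_Sup)
  also have "\<dots> = sup (x * y) (x * y')" by simp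
  finally show ?thesis by (metis sup.cobounded1)
qed

lemma le_qhom_iff: "x \<le> qhom y z \<longleftrightarrow> x * y \<le> (z::'v::comm_quantale)"
proof
  assume "x \<le> qhom y z"
  then have "y * x \<le> y * qhom y z" by (rule qmult_mono)
  also have "\<dots> \<le> z"
    unfolding qhom_def mult_Sup by (rule Sup_least) (auto simp: mult.commute)
  finally show "x * y \<le> z" by (simp add: mult.commute)
qed (auto simp: qhom_def intro: Sup_upper)


section \<open>The category of sets\<close>

text \<open>
  The category \<open>Set\<close> is that of an arbitrary model \<open>'u\<close> of (a fragment of) set theory:
  \<open>E x\<close> is the collection of members of \<open>x\<close>, and a collection \<open>X :: 'u set\<close> is a set of the
  model (\<open>small\<close>) if it is of the form \<open>E x\<close>. Extensionality, separation, pairing, union and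
  power set are all that is asked for, so models of ZFC are included. A morphism \<open>X \<rightarrow> Y\<close> of
  \<open>Set\<close> is a function in \<open>X \<rightarrow> Y\<close>, where functions that agree on \<open>X\<close> are identified.
\<close>

definition small :: "('u \<Rightarrow> 'u set) \<Rightarrow> 'u set \<Rightarrow> bool" where
  "small E X \<longleftrightarrow> X \<in> range E"

locale set_universe =
  fixes E :: "'u \<Rightarrow> 'u set"
  assumes extensionality: "inj E"
    and separation: "small E X \<Longrightarrow> Y \<subseteq> X \<Longrightarrow> small E Y"
    and pairing: "small E {x, y}"
    and union: "small E X \<Longrightarrow> small E (\<Union> (E ` X))"
    and power_set: "small E X \<Longrightarrow> small E {y. E y \<subseteq> X}"

definition mk_set :: "('u \<Rightarrow> 'u set) \<Rightarrow> 'u set \<Rightarrow> 'u" where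
  "mk_set E X = inv E X"

definition opair :: "('u \<Rightarrow> 'u set) \<Rightarrow> 'u \<Rightarrow> 'u \<Rightarrow> 'u" where
  "opair E x y = mk_set E {mk_set E {x}, mk_set E {x, y}}"

definition ofst :: "('u \<Rightarrow> 'u set) \<Rightarrow> 'u \<Rightarrow> 'u" where
  "ofst E p = (THE x. \<exists>y. p = opair E x y)"

definition osnd :: "('u \<Rightarrow> 'u set) \<Rightarrow> 'u \<Rightarrow> 'u" where
  "osnd E p = (THE y. \<exists>x. p = opair E x y)"

definition oprod :: "('u \<Rightarrow> 'u set) \<Rightarrow> 'u set \<Rightarrow> 'u set \<Rightarrow> 'u set" where
  "oprod E X Y = {opair E x y | x y. x \<in> X \<and> y \<in> Y}"

text \<open>A function on \<open>X\<close> as an element of the model (its graph), and back.\<close>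

definition graph_of :: "('u \<Rightarrow> 'u set) \<Rightarrow> 'u set \<Rightarrow> ('u \<Rightarrow> 'u) \<Rightarrow> 'u" where
  "graph_of E X f = mk_set E ((\<lambda>x. opair E x (f x)) ` X)"

definition fun_of :: "('u \<Rightarrow> 'u set) \<Rightarrow> 'u set \<Rightarrow> 'u \<Rightarrow> 'u \<Rightarrow> 'u" where
  "fun_of E X g = (\<lambda>x\<in>X. THE y. opair E x y \<in> E g)"

context set_universe
begin

lemma E_mk_set: "small E X \<Longrightarrow> E (mk_set E X) = X"
  by (simp add: small_def mk_set_def f_inv_into_f)

lemma opair_inject: "opair E x y = opair E x' y' \<longleftrightarrow> x = x' \<and> y = y'"
proof
  assume eq: "opair E x y = opair E x' y'"
  have E2: "E (mk_set E {a, b}) = {a, b}" for a b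
    by (rule E_mk_set[OF pairing])
  have E1: "E (mk_set E {a}) = {a}" for a
    using E2[of a a] by simp
  have "{mk_set E {x}, mk_set E {x, y}} = {mk_set E {x'}, mk_set E {x', y'}}"
    using arg_cong[OF eq, of E] by (simp add: opair_def E2)
  then have "E ` {mk_set E {x}, mk_set E {x, y}} = E ` {mk_set E {x'}, mk_set E {x', y'}}"
    by simp
  then have "{{x}, {x, y}} = {{x'}, {x', y'}}" by (simp add: E1 E2)
  then show "x = x' \<and> y = y'" by (auto simp: doubleton_eq_iff)
qed simp

lemma ofst_opair [simp]: "ofst E (opair E x y) = x"
  and osnd_opair [simp]: "osnd E (opair E x y) = y"
  by (auto simp: ofst_def osnd_def opair_inject)

end

definition weak_pullback ::
  "('u \<Rightarrow> 'u set) \<Rightarrow> 'u set \<Rightarrow> 'u set \<Rightarrow> 'u set \<Rightarrow> 'u set \<Rightarrow>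
    ('u \<Rightarrow> 'u) \<Rightarrow> ('u \<Rightarrow> 'u) \<Rightarrow> ('u \<Rightarrow> 'u) \<Rightarrow> ('u \<Rightarrow> 'u) \<Rightarrow> bool" where
  "weak_pullback E P X Y Z p q f g \<longleftrightarrow>
     small E P \<and> small E X \<and> small E Y \<and> small E Z \<and>
     p \<in> P \<rightarrow> X \<and> q \<in> P \<rightarrow> Y \<and> f \<in> X \<rightarrow> Z \<and> g \<in> Y \<rightarrow> Z \<and>
     (\<forall>w\<in>P. f (p w) = g (q w)) \<and>
     (\<forall>W u v. small E W \<and> u \<in> W \<rightarrow> X \<and> v \<in> W \<rightarrow> Y \<and> (\<forall>w\<in>W. f (u w) = g (v w)) \<longrightarrow>
        (\<exists>h. h \<in> W \<rightarrow>\<^sub>E P \<and> (\<forall>w\<in>W. p (h w) = u w \<and> q (h w) = v w)))"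

definition pullback ::
  "('u \<Rightarrow> 'u set) \<Rightarrow> 'u set \<Rightarrow> 'u set \<Rightarrow> 'u set \<Rightarrow> 'u set \<Rightarrow>
    ('u \<Rightarrow> 'u) \<Rightarrow> ('u \<Rightarrow> 'u) \<Rightarrow> ('u \<Rightarrow> 'u) \<Rightarrow> ('u \<Rightarrow> 'u) \<Rightarrow> bool" where
  "pullback E P X Y Z p q f g \<longleftrightarrow>
     small E P \<and> small E X \<and> small E Y \<and> small E Z \<and>
     p \<in> P \<rightarrow> X \<and> q \<in> P \<rightarrow> Y \<and> f \<in> X \<rightarrow> Z \<and> g \<in> Y \<rightarrow> Z \<and>
     (\<forall>w\<in>P. f (p w) = g (q w)) \<and>
     (\<forall>W u v. small E W \<and> u \<in> W \<rightarrow> X \<and> v \<in> W \<rightarrow> Y \<and> (\<forall>w\<in>W. f (u w) = g (v w)) \<longrightarrow>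
        (\<exists>!h. h \<in> W \<rightarrow>\<^sub>E P \<and> (\<forall>w\<in>W. p (h w) = u w \<and> q (h w) = v w)))"


section \<open>Strict topological theories\<close>

text \<open>
  \<open>Tmap T X Y f\<close> is the map \<open>TX \<rightarrow> TY\<close> induced by \<open>f\<close> regarded as a map \<open>X \<rightarrow> Y\<close>.
  The quantale is a type \<open>'v\<close>; it is made an object of \<open>Set\<close> by the injection \<open>emb\<close>,
  whose range \<open>Vset\<close> is required to be small.
\<close>

record ('u, 'v) top_theory =
  elts :: "'u \<Rightarrow> 'u set"
  Tob :: "'u set \<Rightarrow> 'u set"
  Tmap :: "'u set \<Rightarrow> 'u set \<Rightarrow> ('u \<Rightarrow> 'u) \<Rightarrow> 'u \<Rightarrow> 'u"
  Tmult :: "'u set \<Rightarrow> 'u \<Rightarrow> 'u"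
  Tunit :: "'u set \<Rightarrow> 'u \<Rightarrow> 'u"
  emb :: "'v \<Rightarrow> 'u"
  xi :: "'u \<Rightarrow> 'v"

definition Vset :: "('u, 'v) top_theory \<Rightarrow> 'u set" where
  "Vset T = range (emb T)"

definition val :: "('u, 'v) top_theory \<Rightarrow> 'u \<Rightarrow> 'v" where
  "val T = inv (emb T)"

definition xi_on :: "('u, 'v) top_theory \<Rightarrow> 'u set \<Rightarrow> ('u \<Rightarrow> 'v) \<Rightarrow> 'u \<Rightarrow> 'v" where
  "xi_on T X \<phi> t = xi T (Tmap T X (Vset T) (\<lambda>x. emb T (\<phi> x)) t)"

locale set_monad =
  fixes T :: "('u, 'v) top_theory"
  assumes universe: "set_universe (elts T)"
    and Tob_small: "small (elts T) X \<Longrightarrow> small (elts T) (Tob T X)"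
    and Tmap_funcset: "small (elts T) X \<Longrightarrow> small (elts T) Y \<Longrightarrow> f \<in> X \<rightarrow> Y \<Longrightarrow>
      Tmap T X Y f \<in> Tob T X \<rightarrow> Tob T Y"
    and Tmap_cong: "small (elts T) X \<Longrightarrow> small (elts T) Y \<Longrightarrow> f \<in> X \<rightarrow> Y \<Longrightarrow>
      (\<And>x. x \<in> X \<Longrightarrow> f x = g x) \<Longrightarrow> t \<in> Tob T X \<Longrightarrow> Tmap T X Y f t = Tmap T X Y g t"
    and Tmap_id: "small (elts T) X \<Longrightarrow> t \<in> Tob T X \<Longrightarrow> Tmap T X X (\<lambda>x. x) t = t"
    and Tmap_comp: "small (elts T) X \<Longrightarrow> small (elts T) Y \<Longrightarrow> small (elts T) Z \<Longrightarrow>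
      f \<in> X \<rightarrow> Y \<Longrightarrow> g \<in> Y \<rightarrow> Z \<Longrightarrow> t \<in> Tob T X \<Longrightarrow>
      Tmap T X Z (\<lambda>x. g (f x)) t = Tmap T Y Z g (Tmap T X Y f t)"
    and Tunit_funcset: "small (elts T) X \<Longrightarrow> Tunit T X \<in> X \<rightarrow> Tob T X"
    and Tunit_natural: "small (elts T) X \<Longrightarrow> small (elts T) Y \<Longrightarrow> f \<in> X \<rightarrow> Y \<Longrightarrow> x \<in> X \<Longrightarrow>
      Tmap T X Y f (Tunit T X x) = Tunit T Y (f x)"
    and Tmult_funcset: "small (elts T) X \<Longrightarrow> Tmult T X \<in> Tob T (Tob T X) \<rightarrow> Tob T X"
    and Tmult_natural: "small (elts T) X \<Longrightarrow> small (elts T) Y \<Longrightarrow> f \<in> X \<rightarrow> Y \<Longrightarrow>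
      t \<in> Tob T (Tob T X) \<Longrightarrow>
      Tmap T X Y f (Tmult T X t) = Tmult T Y (Tmap T (Tob T X) (Tob T Y) (Tmap T X Y f) t)"
    and Tmult_Tunit: "small (elts T) X \<Longrightarrow> t \<in> Tob T X \<Longrightarrow>
      Tmult T X (Tunit T (Tob T X) t) = t"
    and Tmult_Tmap_Tunit: "small (elts T) X \<Longrightarrow> t \<in> Tob T X \<Longrightarrow>
      Tmult T X (Tmap T X (Tob T X) (Tunit T X) t) = t"
    and Tmult_assoc: "small (elts T) X \<Longrightarrow> t \<in> Tob T (Tob T (Tob T X)) \<Longrightarrow>
      Tmult T X (Tmult T (Tob T X) t) =
      Tmult T X (Tmap T (Tob T (Tob T X)) (Tob T X) (Tmult T X) t)"

definition T_algebra :: "('u, 'v) top_theory \<Rightarrow> 'u set \<Rightarrow> ('u \<Rightarrow> 'u) \<Rightarrow> bool" where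
  "T_algebra T I \<alpha> \<longleftrightarrow>
     small (elts T) I \<and> \<alpha> \<in> Tob T I \<rightarrow> I \<and>
     (\<forall>i\<in>I. \<alpha> (Tunit T I i) = i) \<and>
     (\<forall>t\<in>Tob T (Tob T I). \<alpha> (Tmap T (Tob T I) I \<alpha> t) = \<alpha> (Tmult T I t))"

locale strict_topological_theory = set_monad T
  for T :: "('u, 'v::comm_quantale) top_theory" +
  assumes pullback_to_weak: "pullback (elts T) P X Y Z p q f g \<Longrightarrow>
      weak_pullback (elts T) (Tob T P) (Tob T X) (Tob T Y) (Tob T Z)
        (Tmap T P X p) (Tmap T P Y q) (Tmap T X Z f) (Tmap T Y Z g)"
    and Tmult_weak_pullback: "small (elts T) X \<Longrightarrow> small (elts T) Y \<Longrightarrow> f \<in> X \<rightarrow> Y \<Longrightarrow>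
      weak_pullback (elts T) (Tob T (Tob T X)) (Tob T X) (Tob T (Tob T Y)) (Tob T Y)
        (Tmult T X) (Tmap T (Tob T X) (Tob T Y) (Tmap T X Y f)) (Tmap T X Y f) (Tmult T Y)"
    and emb_inj: "inj (emb T)"
    and Vset_small: "small (elts T) (Vset T)"
    and xi_algebra: "T_algebra T (Vset T) (\<lambda>t. emb T (xi T t))"
    and xi_mult: "w \<in> Tob T (oprod (elts T) (Vset T) (Vset T)) \<Longrightarrow>
      xi_on T (oprod (elts T) (Vset T) (Vset T))
        (\<lambda>p. val T (ofst (elts T) p) * val T (osnd (elts T) p)) w =
      xi T (Tmap T (oprod (elts T) (Vset T) (Vset T)) (Vset T) (ofst (elts T)) w) *
      xi T (Tmap T (oprod (elts T) (Vset T) (Vset T)) (Vset T) (osnd (elts T)) w)"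
    and xi_unit: "t \<in> Tob T {z} \<Longrightarrow> xi_on T {z} (\<lambda>_. 1) t = 1"
    and xi_mono: "small (elts T) X \<Longrightarrow> (\<And>x. x \<in> X \<Longrightarrow> \<phi> x \<le> \<phi>' x) \<Longrightarrow> t \<in> Tob T X \<Longrightarrow>
      xi_on T X \<phi> t \<le> xi_on T X \<phi>' t"
    and xi_natural: "small (elts T) X \<Longrightarrow> small (elts T) Y \<Longrightarrow> f \<in> X \<rightarrow> Y \<Longrightarrow> t \<in> Tob T Y \<Longrightarrow>
      xi_on T Y (\<lambda>y. SUP x\<in>{x\<in>X. f x = y}. \<phi> x) t =
      (SUP s\<in>{s\<in>Tob T X. Tmap T X Y f s = t}. xi_on T X \<phi> s)"

text \<open>The condition \<open>T1 = 1\<close>.\<close>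

definition T_one :: "('u, 'v) top_theory \<Rightarrow> bool" where
  "T_one T \<longleftrightarrow> (\<forall>z. is_singleton (Tob T {z}))"


section \<open>\<open>\<T>\<close>-graphs and \<open>\<T>\<close>-categories\<close>

text \<open>Only the values \<open>tstr A \<xx> x\<close> with \<open>\<xx> \<in> T(tpts A)\<close> and \<open>x \<in> tpts A\<close> are relevant.\<close>

record ('u, 'v) tgraph =
  tpts :: "'u set"
  tstr :: "'u \<Rightarrow> 'u \<Rightarrow> 'v"

text \<open>The extension \<open>T_\<xi> r\<close> of a matrix \<open>r : X \<rightarrow> Y\<close>, that is, \<open>r : Y \<times> X \<rightarrow> V\<close>.\<close>

definition T_ext ::
  "('u, 'v::comm_quantale) top_theory \<Rightarrow> 'u set \<Rightarrow> 'u set \<Rightarrow> ('u \<Rightarrow> 'u \<Rightarrow> 'v) \<Rightarrow> 'u \<Rightarrow> 'u \<Rightarrow> 'v"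
where
  "T_ext T Y X r \<yy> \<xx> =
     (SUP w\<in>{w \<in> Tob T (oprod (elts T) Y X).
        Tmap T (oprod (elts T) Y X) Y (ofst (elts T)) w = \<yy> \<and>
        Tmap T (oprod (elts T) Y X) X (osnd (elts T)) w = \<xx>}.
      xi_on T (oprod (elts T) Y X) (\<lambda>p. r (ofst (elts T) p) (osnd (elts T) p)) w)"

definition T_graph :: "('u, 'v::comm_quantale) top_theory \<Rightarrow> ('u, 'v) tgraph \<Rightarrow> bool" where
  "T_graph T A \<longleftrightarrow>
     small (elts T) (tpts A) \<and> (\<forall>x\<in>tpts A. 1 \<le> tstr A (Tunit T (tpts A) x) x)"

definition T_category :: "('u, 'v::comm_quantale) top_theory \<Rightarrow> ('u, 'v) tgraph \<Rightarrow> bool" where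
  "T_category T A \<longleftrightarrow>
     T_graph T A \<and>
     (\<forall>\<XX>\<in>Tob T (Tob T (tpts A)). \<forall>\<yy>\<in>Tob T (tpts A). \<forall>x\<in>tpts A.
        T_ext T (Tob T (tpts A)) (tpts A) (tstr A) \<XX> \<yy> * tstr A \<yy> x
          \<le> tstr A (Tmult T (tpts A) \<XX>) x)"

definition T_morphism ::
  "('u, 'v::comm_quantale) top_theory \<Rightarrow> ('u, 'v) tgraph \<Rightarrow> ('u, 'v) tgraph \<Rightarrow> ('u \<Rightarrow> 'u) \<Rightarrow> bool"
where
  "T_morphism T A B f \<longleftrightarrow>
     f \<in> tpts A \<rightarrow> tpts B \<and>
     (\<forall>\<xx>\<in>Tob T (tpts A). \<forall>x\<in>tpts A.
        tstr A \<xx> x \<le> tstr B (Tmap T (tpts A) (tpts B) f \<xx>) (f x))"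

definition algebra_graph :: "'u set \<Rightarrow> ('u \<Rightarrow> 'u) \<Rightarrow> ('u, 'v::comm_quantale) tgraph" where
  "algebra_graph I \<alpha> = \<lparr>tpts = I, tstr = (\<lambda>\<ii> i. if \<alpha> \<ii> = i then 1 else bot)\<rparr>"

definition V_graph :: "('u, 'v::comm_quantale) top_theory \<Rightarrow> ('u, 'v) tgraph" where
  "V_graph T = \<lparr>tpts = Vset T, tstr = (\<lambda>\<vv> v. qhom (xi T \<vv>) (val T v))\<rparr>"


section \<open>\<open>V\<close>-categories\<close>

text \<open>
  The elements may be of any type, since the presheaf category \<open>PA\<close> consists of functions.
\<close>

record ('a, 'v) vgraph =
  vpts :: "'a set"
  vhom :: "'a \<Rightarrow> 'a \<Rightarrow> 'v"

definition V_category :: "('a, 'v::comm_quantale) vgraph \<Rightarrow> bool" where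
  "V_category A \<longleftrightarrow>
     (\<forall>x\<in>vpts A. 1 \<le> vhom A x x) \<and>
     (\<forall>x\<in>vpts A. \<forall>y\<in>vpts A. \<forall>z\<in>vpts A. vhom A x y * vhom A y z \<le> vhom A x z)"

definition V_functor ::
  "('a, 'v::comm_quantale) vgraph \<Rightarrow> ('b, 'v) vgraph \<Rightarrow> ('a \<Rightarrow> 'b) \<Rightarrow> bool" where
  "V_functor A B f \<longleftrightarrow>
     f \<in> vpts A \<rightarrow> vpts B \<and>
     (\<forall>x\<in>vpts A. \<forall>y\<in>vpts A. vhom A x y \<le> vhom B (f x) (f y))"

text \<open>Distributors \<open>1 \<rightarrow> A\<close> and \<open>A \<rightarrow> 1\<close>, respectively.\<close>

definition distributor_from_one :: "('a, 'v::comm_quantale) vgraph \<Rightarrow> ('a \<Rightarrow> 'v) \<Rightarrow> bool" where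
  "distributor_from_one A \<phi> \<longleftrightarrow> (\<forall>x\<in>vpts A. \<forall>y\<in>vpts A. vhom A x y * \<phi> y \<le> \<phi> x)"

definition distributor_to_one :: "('a, 'v::comm_quantale) vgraph \<Rightarrow> ('a \<Rightarrow> 'v) \<Rightarrow> bool" where
  "distributor_to_one A \<phi> \<longleftrightarrow> (\<forall>x\<in>vpts A. \<forall>y\<in>vpts A. \<phi> x * vhom A x y \<le> \<phi> y)"

definition presheaves :: "('a, 'v::comm_quantale) vgraph \<Rightarrow> ('a \<Rightarrow> 'v, 'v) vgraph" where
  "presheaves A =
     \<lparr>vpts = {\<phi> \<in> extensional (vpts A). distributor_from_one A \<phi>},
      vhom = (\<lambda>\<phi> \<phi>'. INF x\<in>vpts A. qhom (\<phi> x) (\<phi>' x))\<rparr>"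

text \<open>
  The following are relations rather than functions, because the objects in question are
  determined only up to isomorphism.
\<close>

definition is_sup :: "('a, 'v::comm_quantale) vgraph \<Rightarrow> ('a \<Rightarrow> 'v) \<Rightarrow> 'a \<Rightarrow> bool" where
  "is_sup A \<phi> c \<longleftrightarrow>
     c \<in> vpts A \<and> (\<forall>y\<in>vpts A. vhom A c y = (INF x\<in>vpts A. qhom (\<phi> x) (vhom A x y)))"

definition is_colimit ::
  "('a, 'v::comm_quantale) vgraph \<Rightarrow> ('i, 'v) vgraph \<Rightarrow> ('i \<Rightarrow> 'v) \<Rightarrow> ('i \<Rightarrow> 'a) \<Rightarrow> 'a \<Rightarrow> bool" where
  "is_colimit A I \<psi> h c \<longleftrightarrow>
     c \<in> vpts A \<and> (\<forall>y\<in>vpts A. vhom A c y = (INF i\<in>vpts I. qhom (\<psi> i) (vhom A (h i) y)))"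

definition is_limit ::
  "('a, 'v::comm_quantale) vgraph \<Rightarrow> ('i, 'v) vgraph \<Rightarrow> ('i \<Rightarrow> 'v) \<Rightarrow> ('i \<Rightarrow> 'a) \<Rightarrow> 'a \<Rightarrow> bool" where
  "is_limit A I \<phi> h c \<longleftrightarrow>
     c \<in> vpts A \<and> (\<forall>y\<in>vpts A. vhom A y c = (INF i\<in>vpts I. qhom (\<phi> i) (vhom A y (h i))))"

definition is_tensor :: "('a, 'v::comm_quantale) vgraph \<Rightarrow> 'v \<Rightarrow> 'a \<Rightarrow> 'a \<Rightarrow> bool" where
  "is_tensor A v x t \<longleftrightarrow>
     t \<in> vpts A \<and> (\<forall>y\<in>vpts A. vhom A t y = qhom v (vhom A x y))"

definition V_complete ::
  "('u, 'v::comm_quantale) top_theory \<Rightarrow> ('u, 'v) vgraph \<Rightarrow> bool" where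
  "V_complete T A \<longleftrightarrow>
     (\<forall>(I :: ('u, 'v) vgraph) \<phi> h.
        small (elts T) (vpts I) \<and> V_category I \<and> distributor_to_one I \<phi> \<and> V_functor I A h \<longrightarrow>
        (\<exists>c. is_limit A I \<phi> h c))"

definition underlying ::
  "('u, 'v) top_theory \<Rightarrow> ('u, 'v) tgraph \<Rightarrow> ('u, 'v) vgraph" where
  "underlying T A =
     \<lparr>vpts = tpts A, vhom = (\<lambda>x' x. tstr A (Tunit T (tpts A) x') x)\<rparr>"


section \<open>\<open>\<T>\<close>-frames\<close>

text \<open>
  The points \<open>t i\<close> are tensors \<open>\<psi>(i) \<otimes> h(i)\<close>. These are unique only up to isomorphism, and
  in a \<open>\<T>\<close>-graph isomorphic points need not be interchangeable; the requirement is that the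
  tensors can be chosen so as to form a \<open>\<T>\<close>-graph morphism.
\<close>

definition T_weighted_diagram ::
  "('u, 'v::comm_quantale) top_theory \<Rightarrow> ('u, 'v) tgraph \<Rightarrow>
    ('u, 'v) vgraph \<Rightarrow> ('u \<Rightarrow> 'u) \<Rightarrow> ('u \<Rightarrow> 'u) \<Rightarrow> ('u \<Rightarrow> 'v) \<Rightarrow> bool" where
  "T_weighted_diagram T A I \<alpha> h \<psi> \<longleftrightarrow>
     T_algebra T (vpts I) \<alpha> \<and> V_category I \<and>
     V_functor I (underlying T A) h \<and> distributor_from_one I \<psi> \<and>
     (\<exists>t. (\<forall>i\<in>vpts I. is_tensor (underlying T A) (\<psi> i) (h i) (t i)) \<and>
          T_morphism T (algebra_graph (vpts I) \<alpha>) A t)"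

definition T_generated ::
  "('u, 'v::comm_quantale) top_theory \<Rightarrow> ('u, 'v) tgraph \<Rightarrow> ('u \<Rightarrow> 'v) \<Rightarrow> bool" where
  "T_generated T A \<phi> \<longleftrightarrow>
     distributor_from_one (underlying T A) \<phi> \<and>
     (\<exists>I \<alpha> h \<psi>. T_weighted_diagram T A I \<alpha> h \<psi> \<and>
        (\<forall>x\<in>tpts A. \<phi> x = (SUP i\<in>vpts I. vhom (underlying T A) x (h i) * \<psi> i)))"

definition T_frame :: "('u, 'v::comm_quantale) top_theory \<Rightarrow> ('u, 'v) tgraph \<Rightarrow> bool" where
  "T_frame T A \<longleftrightarrow>
     T_graph T A \<and> V_category (underlying T A) \<and> V_complete T (underlying T A) \<and>
     (\<forall>(I :: ('u, 'v) vgraph) \<phi> h l s c.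
        small (elts T) (vpts I) \<and> V_category I \<and> distributor_to_one I \<phi> \<and>
        V_functor I (presheaves (underlying T A)) h \<and>
        (\<forall>i\<in>vpts I. T_generated T A (h i)) \<and>
        is_limit (presheaves (underlying T A)) I \<phi> h l \<and> T_generated T A l \<and>
        (\<forall>i\<in>vpts I. is_sup (underlying T A) (h i) (s i)) \<and>
        is_sup (underlying T A) l c \<longrightarrow>
        is_limit (underlying T A) I \<phi> s c)"

definition T_compatible ::
  "('u, 'v::comm_quantale) top_theory \<Rightarrow> ('u, 'v) tgraph \<Rightarrow> ('u, 'v) tgraph \<Rightarrow> ('u \<Rightarrow> 'u) \<Rightarrow> bool"
where
  "T_compatible T A B f \<longleftrightarrow>
     (\<forall>I \<alpha> h. T_algebra T I \<alpha> \<and> T_morphism T (algebra_graph I \<alpha>) A h \<longrightarrow>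
        T_morphism T (algebra_graph I \<alpha>) B (\<lambda>i. f (h i)))"

definition preserves_limits ::
  "('u, 'v::comm_quantale) top_theory \<Rightarrow> ('u, 'v) vgraph \<Rightarrow> ('u, 'v) vgraph \<Rightarrow> ('u \<Rightarrow> 'u) \<Rightarrow> bool"
where
  "preserves_limits T A B f \<longleftrightarrow>
     (\<forall>(I :: ('u, 'v) vgraph) \<phi> h c.
        small (elts T) (vpts I) \<and> V_category I \<and> distributor_to_one I \<phi> \<and> V_functor I A h \<and>
        is_limit A I \<phi> h c \<longrightarrow>
        is_limit B I \<phi> (\<lambda>i. f (h i)) (f c))"

definition preserves_T_colimits ::
  "('u, 'v::comm_quantale) top_theory \<Rightarrow> ('u, 'v) tgraph \<Rightarrow> ('u, 'v) tgraph \<Rightarrow> ('u \<Rightarrow> 'u) \<Rightarrow> bool"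
where
  "preserves_T_colimits T A B f \<longleftrightarrow>
     (\<forall>I \<alpha> h \<psi> c.
        T_weighted_diagram T A I \<alpha> h \<psi> \<and> is_colimit (underlying T A) I \<psi> h c \<longrightarrow>
        is_colimit (underlying T B) I \<psi> (\<lambda>i. f (h i)) (f c))"

definition T_frame_hom ::
  "('u, 'v::comm_quantale) top_theory \<Rightarrow> ('u, 'v) tgraph \<Rightarrow> ('u, 'v) tgraph \<Rightarrow> ('u \<Rightarrow> 'u) \<Rightarrow> bool"
where
  "T_frame_hom T A B f \<longleftrightarrow>
     V_functor (underlying T A) (underlying T B) f \<and> T_compatible T A B f \<and>
     preserves_limits T (underlying T A) (underlying T B) f \<and> preserves_T_colimits T A B f"


section \<open>Categories and functors\<close>

text \<open>\<open>cmp C A B D g f\<close> is the composite of \<open>f : A \<rightarrow> B\<close> and \<open>g : B \<rightarrow> D\<close>.\<close>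

record ('o, 'm) category =
  Ob :: "'o set"
  Hom :: "'o \<Rightarrow> 'o \<Rightarrow> 'm set"
  ident :: "'o \<Rightarrow> 'm"
  cmp :: "'o \<Rightarrow> 'o \<Rightarrow> 'o \<Rightarrow> 'm \<Rightarrow> 'm \<Rightarrow> 'm"

definition is_category :: "('o, 'm) category \<Rightarrow> bool" where
  "is_category C \<longleftrightarrow>
     (\<forall>A\<in>Ob C. ident C A \<in> Hom C A A) \<and>
     (\<forall>A\<in>Ob C. \<forall>B\<in>Ob C. \<forall>D\<in>Ob C. \<forall>f\<in>Hom C A B. \<forall>g\<in>Hom C B D.
        cmp C A B D g f \<in> Hom C A D) \<and>
     (\<forall>A\<in>Ob C. \<forall>B\<in>Ob C. \<forall>f\<in>Hom C A B.
        cmp C A A B f (ident C A) = f \<and> cmp C A B B (ident C B) f = f) \<and>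
     (\<forall>A\<in>Ob C. \<forall>B\<in>Ob C. \<forall>D\<in>Ob C. \<forall>F\<in>Ob C.
        \<forall>f\<in>Hom C A B. \<forall>g\<in>Hom C B D. \<forall>h\<in>Hom C D F.
        cmp C A D F h (cmp C A B D g f) = cmp C A B F (cmp C B D F h g) f)"

definition opposite :: "('o, 'm) category \<Rightarrow> ('o, 'm) category" where
  "opposite C =
     \<lparr>Ob = Ob C, Hom = (\<lambda>A B. Hom C B A), ident = ident C,
      cmp = (\<lambda>A B D g f. cmp C D B A f g)\<rparr>"

record ('o, 'm, 'p, 'n) func =
  fob :: "'o \<Rightarrow> 'p"
  farr :: "'o \<Rightarrow> 'o \<Rightarrow> 'm \<Rightarrow> 'n"

definition is_functor ::
  "('o, 'm) category \<Rightarrow> ('p, 'n) category \<Rightarrow> ('o, 'm, 'p, 'n) func \<Rightarrow> bool" where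
  "is_functor C D F \<longleftrightarrow>
     is_category C \<and> is_category D \<and>
     (\<forall>A\<in>Ob C. fob F A \<in> Ob D) \<and>
     (\<forall>A\<in>Ob C. \<forall>B\<in>Ob C. \<forall>f\<in>Hom C A B. farr F A B f \<in> Hom D (fob F A) (fob F B)) \<and>
     (\<forall>A\<in>Ob C. farr F A A (ident C A) = ident D (fob F A)) \<and>
     (\<forall>A\<in>Ob C. \<forall>B\<in>Ob C. \<forall>K\<in>Ob C. \<forall>f\<in>Hom C A B. \<forall>g\<in>Hom C B K.
        farr F A K (cmp C A B K g f) =
        cmp D (fob F A) (fob F B) (fob F K) (farr F B K g) (farr F A B f))"

definition comp_func ::
  "('p, 'n, 'q, 'l) func \<Rightarrow> ('o, 'm, 'p, 'n) func \<Rightarrow> ('o, 'm, 'q, 'l) func" where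
  "comp_func G F =
     \<lparr>fob = (\<lambda>A. fob G (fob F A)),
      farr = (\<lambda>A B f. farr G (fob F A) (fob F B) (farr F A B f))\<rparr>"

definition functor_eq ::
  "('o, 'm) category \<Rightarrow> ('o, 'm, 'p, 'n) func \<Rightarrow> ('o, 'm, 'p, 'n) func \<Rightarrow> bool" where
  "functor_eq C F G \<longleftrightarrow>
     (\<forall>A\<in>Ob C. fob F A = fob G A) \<and>
     (\<forall>A\<in>Ob C. \<forall>B\<in>Ob C. \<forall>f\<in>Hom C A B. farr F A B f = farr G A B f)"

definition lifts_to ::
  "('o, 'm) category \<Rightarrow> ('p, 'n) category \<Rightarrow> ('p, 'n, 'q, 'l) func \<Rightarrow>
    ('o, 'm, 'q, 'l) func \<Rightarrow> ('o, 'm, 'p, 'n) func \<Rightarrow> bool" where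
  "lifts_to C D U G F \<longleftrightarrow> is_functor C D F \<and> functor_eq C (comp_func U F) G"

text \<open>A preordered set is a pair \<open>(X, R)\<close> with \<open>(x, y) \<in> R\<close> if and only if \<open>x \<le> y\<close>.\<close>

definition Ord_cat :: "('u \<Rightarrow> 'u set) \<Rightarrow> ('u set \<times> ('u \<times> 'u) set, 'u \<Rightarrow> 'u) category" where
  "Ord_cat E =
     \<lparr>Ob = {(X, R). small E X \<and> preorder_on X R},
      Hom = (\<lambda>(X, R) (Y, S). {f \<in> X \<rightarrow>\<^sub>E Y. \<forall>(x, y)\<in>R. (f x, f y) \<in> S}),
      ident = (\<lambda>(X, R). restrict id X),
      cmp = (\<lambda>(X, R) Y Z g f. compose X g f)\<rparr>"

definition TCat ::
  "('u, 'v::comm_quantale) top_theory \<Rightarrow> (('u, 'v) tgraph, 'u \<Rightarrow> 'u) category" where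
  "TCat T =
     \<lparr>Ob = {A. T_category T A},
      Hom = (\<lambda>A B. {f \<in> tpts A \<rightarrow>\<^sub>E tpts B. T_morphism T A B f}),
      ident = (\<lambda>A. restrict id (tpts A)),
      cmp = (\<lambda>A B C g f. compose (tpts A) g f)\<rparr>"

definition TFrm ::
  "('u, 'v::comm_quantale) top_theory \<Rightarrow> (('u, 'v) tgraph, 'u \<Rightarrow> 'u) category" where
  "TFrm T =
     \<lparr>Ob = {A. T_frame T A},
      Hom = (\<lambda>A B. {f \<in> tpts A \<rightarrow>\<^sub>E tpts B. T_frame_hom T A B f}),
      ident = (\<lambda>A. restrict id (tpts A)),
      cmp = (\<lambda>A B C g f. compose (tpts A) g f)\<rparr>"

definition forgetful ::
  "('u, 'v::comm_quantale) top_theory \<Rightarrow>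
    (('u, 'v) tgraph, 'u \<Rightarrow> 'u, 'u set \<times> ('u \<times> 'u) set, 'u \<Rightarrow> 'u) func" where
  "forgetful T =
     \<lparr>fob = (\<lambda>A. (tpts A, {(x', x). x' \<in> tpts A \<and> x \<in> tpts A \<and>
                                  1 \<le> tstr A (Tunit T (tpts A) x') x})),
      farr = (\<lambda>A B f. f)\<rparr>"

text \<open>
  The contravariant functor \<open>\<T>-Frm(-, V)\<close>. Its value at \<open>A\<close> is a set of functions, which become
  elements of the set-theoretic universe by passing to their graphs. An arrow \<open>A \<rightarrow> B\<close> of the
  opposite category is a homomorphism \<open>f : B \<rightarrow> A\<close>, and acts by \<open>p \<mapsto> p \<cdot> f\<close>.
\<close>

definition frame_points :: "('u, 'v::comm_quantale) top_theory \<Rightarrow> ('u, 'v) tgraph \<Rightarrow> 'u set" where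
  "frame_points T A = graph_of (elts T) (tpts A) ` Hom (TFrm T) A (V_graph T)"

definition hom_V ::
  "('u, 'v::comm_quantale) top_theory \<Rightarrow>
    (('u, 'v) tgraph, 'u \<Rightarrow> 'u, 'u set \<times> ('u \<times> 'u) set, 'u \<Rightarrow> 'u) func" where
  "hom_V T =
     \<lparr>fob = (\<lambda>A. (frame_points T A,
         {(graph_of (elts T) (tpts A) p, graph_of (elts T) (tpts A) q) | p q.
            p \<in> Hom (TFrm T) A (V_graph T) \<and> q \<in> Hom (TFrm T) A (V_graph T) \<and>
            (\<forall>x\<in>tpts A. val T (p x) \<le> val T (q x))})),
      farr = (\<lambda>A B f. \<lambda>p\<in>frame_points T A.
         graph_of (elts T) (tpts B)
           (cmp (TFrm T) B A (V_graph T) (fun_of (elts T) (tpts A) p) f))\<rparr>"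

end

theory Submission
  imports Defs
begin

text \<open>
  The structure on the points of \<open>A\<close> is the initial one with respect to the evaluations
  \<open>ev\<^sub>x\<close> into \<open>V\<close>, that is, \<open>(\<pp>, p) \<mapsto> \<Sqinter>\<^sub>x hom(\<xi>(T ev\<^sub>x \<pp>), p x)\<close>. It is transitive because
  \<open>\<xi>\<close> is an algebra structure compatible with the multiplication of \<open>V\<close>, and precomposition with
  \<open>f\<close> is a morphism because \<open>ev\<^sub>x (p \<cdot> f) = ev\<^bsub>f x\<^esub> p\<close>. That \<open>V\<close> is a frame is due to the fact that
  the supremum of any distributor \<open>\<phi> : 1 \<rightarrow> V\<close> is \<open>\<phi>(k)\<close>, so that suprema commute with all limits.
  The condition \<open>T1 = 1\<close> makes tensors \<open>\<T>\<close>-weighted colimits over the one-point algebra; hence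
  frame homomorphisms preserve tensors, and therefore \<open>\<T>\<close>-weighted diagrams.
\<close>

section \<open>Quantales and \<open>V\<close>-categories\<close>

lemma qmult_mono2:
  fixes x :: "'v::comm_quantale"
  assumes "x \<le> x'" "y \<le> y'" shows "x * y \<le> x' * y'"
  using order_trans[OF qmult_mono[OF assms(1), of y]] qmult_mono[OF assms(2), of x']
  by (simp add: mult.commute)

lemma le_qhom_iff': "x \<le> qhom y z \<longleftrightarrow> y * x \<le> (z::'v::comm_quantale)"
  by (simp add: le_qhom_iff mult.commute)

lemma qhom_mult_le: "y * qhom y z \<le> (z::'v::comm_quantale)"
  using le_qhom_iff'[of "qhom y z" y z] by simp

text \<open>Identities between values of \<open>qhom\<close> are proved by comparing lower bounds,
  since the adjunction with \<otimes> describes exactly these.\<close>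

lemma eq_if_same_lower_bounds: "(\<And>x. x \<le> a \<longleftrightarrow> x \<le> b) \<Longrightarrow> a = (b::'a::order)"
  by (metis order.eq_iff order_refl)

lemma qhom_one [simp]: "qhom 1 y = (y::'v::comm_quantale)"
  by (rule eq_if_same_lower_bounds) (simp add: le_qhom_iff)

lemma qhom_left_commute: "qhom x (qhom y z) = qhom y (qhom x (z::'v::comm_quantale))"
  by (rule eq_if_same_lower_bounds) (simp add: le_qhom_iff mult_ac)

lemma qhom_INF: "qhom y (INF i\<in>A. f i) = (INF i\<in>A. qhom y (f i :: 'v::comm_quantale))"
  by (rule eq_if_same_lower_bounds) (simp add: le_qhom_iff le_INF_iff)

lemma one_le_qhom_iff: "1 \<le> qhom x y \<longleftrightarrow> x \<le> (y::'v::comm_quantale)"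
  by (simp add: le_qhom_iff)

lemma SUP_mult_le_iff:
  "(SUP i\<in>A. f i) * y \<le> z \<longleftrightarrow> (\<forall>i\<in>A. f i * y \<le> (z::'v::comm_quantale))"
  by (simp add: le_qhom_iff[symmetric] SUP_le_iff)

section \<open>Presheaves and their weighted limits\<close>

lemma representable_presheaf:
  assumes "V_category A" "a \<in> vpts A"
  shows "(\<lambda>x\<in>vpts A. vhom A x a) \<in> vpts (presheaves A)"
  using assms by (auto simp: presheaves_def distributor_from_one_def V_category_def)

lemma yoneda:
  assumes A: "V_category A" and a: "a \<in> vpts A" and \<chi>: "\<chi> \<in> vpts (presheaves A)"
  shows "vhom (presheaves A) (\<lambda>x\<in>vpts A. vhom A x a) \<chi> = \<chi> a"
proof (rule order.antisym)
  have "vhom (presheaves A) (\<lambda>x\<in>vpts A. vhom A x a) \<chi> \<le> qhom (vhom A a a) (\<chi> a)"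
    using a by (auto simp: presheaves_def intro!: INF_lower2[of a])
  also have "\<dots> = 1 * qhom (vhom A a a) (\<chi> a)"
    by simp
  also have "\<dots> \<le> vhom A a a * qhom (vhom A a a) (\<chi> a)"
    using A a by (intro qmult_mono2) (auto simp: V_category_def)
  also have "\<dots> \<le> \<chi> a"
    by (rule qhom_mult_le)
  finally show "vhom (presheaves A) (\<lambda>x\<in>vpts A. vhom A x a) \<chi> \<le> \<chi> a" .
  \<comment> \<open>By residuation this inequality is the distributor law of \<chi>; the other one
    evaluated the infimum at \<open>a\<close> and used that the unit lies below A(a,a).\<close>
  show "\<chi> a \<le> vhom (presheaves A) (\<lambda>x\<in>vpts A. vhom A x a) \<chi>"
    using \<chi> a by (auto simp: presheaves_def distributor_from_one_def le_INF_iff le_qhom_iff')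
qed

text \<open>Testing the universal property of \<open>l\<close> on the presheaf represented by
  \<open>a\<close> turns all hom-objects into values at \<open>a\<close>, by the Yoneda
  lemma.\<close>

lemma limit_presheaves_pointwise:
  assumes A: "V_category A" and a: "a \<in> vpts A"
    and h: "h \<in> vpts I \<rightarrow> vpts (presheaves A)" and l: "is_limit (presheaves A) I \<phi> h l"
  shows "l a = (INF i\<in>vpts I. qhom (\<phi> i) (h i a))"
proof -
  let ?y = "\<lambda>x\<in>vpts A. vhom A x a"
  have "vhom (presheaves A) ?y l = (INF i\<in>vpts I. qhom (\<phi> i) (vhom (presheaves A) ?y (h i)))"
    using l representable_presheaf[OF A a] by (simp add: is_limit_def)
  also have "\<dots> = (INF i\<in>vpts I. qhom (\<phi> i) (h i a))"
    using h by (intro INF_cong refl) (simp add: yoneda[OF A a] Pi_iff)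
  finally show ?thesis
    using l by (simp add: yoneda[OF A a] is_limit_def)
qed

text \<open>Arrows of the categories are extensional functions, whereas limits and functoriality are
  checked on plain composites such as \<open>\<lambda>x. g (f x)\<close>. Congruence rules mediate
  between the two.\<close>

lemma is_limit_cong:
  "(\<And>i. i \<in> vpts I \<Longrightarrow> h i = h' i) \<Longrightarrow> is_limit A I \<phi> h c \<longleftrightarrow> is_limit A I \<phi> h' c"
  by (simp add: is_limit_def)

lemma is_colimit_cong:
  "(\<And>i. i \<in> vpts I \<Longrightarrow> h i = h' i) \<Longrightarrow> is_colimit A I \<psi> h c \<longleftrightarrow> is_colimit A I \<psi> h' c"
  by (simp add: is_colimit_def)

lemma V_functor_cong:
  "(\<And>x. x \<in> vpts A \<Longrightarrow> f x = g x) \<Longrightarrow> V_functor A B f \<longleftrightarrow> V_functor A B g"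
  by (simp add: V_functor_def Pi_iff)

lemma V_functor_comp: "V_functor A B f \<Longrightarrow> V_functor B C g \<Longrightarrow> V_functor A C (\<lambda>x. g (f x))"
  unfolding V_functor_def Pi_iff by (meson order_trans)

lemma vpts_underlying [simp]: "vpts (underlying T A) = tpts A"
  by (simp add: underlying_def)

section \<open>Sets of pairs and functions\<close>

context set_universe
begin

text \<open>The union axiom is applied to the pair whose members are the codes of \<open>X\<close>
  and \<open>Y\<close>.\<close>

lemma small_Un: "small E X \<Longrightarrow> small E Y \<Longrightarrow> small E (X \<union> Y)"
  using union[OF pairing, of "mk_set E X" "mk_set E Y"] by (simp add: E_mk_set[OF pairing] E_mk_set)

lemma small_singleton: "small E {x}"
  using pairing[of x x] by simp

text \<open>A Kuratowski pair is a set of subsets of the union of \<open>X\<close> and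
  \<open>Y\<close>, so all pairs lie in the double power set of that union.\<close>

lemma small_oprod:
  assumes "small E X" "small E Y"
  shows "small E (oprod E X Y)"
proof (rule separation)
  show "small E {p. E p \<subseteq> {s. E s \<subseteq> X \<union> Y}}"
    by (intro power_set small_Un assms)
  show "oprod E X Y \<subseteq> {p. E p \<subseteq> {s. E s \<subseteq> X \<union> Y}}"
    by (auto simp: oprod_def opair_def E_mk_set[OF pairing] E_mk_set[OF small_singleton])
qed

lemma E_graph_of:
  assumes "small E X" "small E Y" "f \<in> X \<rightarrow> Y"
  shows "E (graph_of E X f) = (\<lambda>x. opair E x (f x)) ` X"
  unfolding graph_of_def
  by (rule E_mk_set, rule separation[OF small_oprod[OF assms(1,2)]])
    (use assms(3) in \<open>auto simp: oprod_def\<close>)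

lemma fun_of_graph_of:
  assumes "small E X" "small E Y" "f \<in> X \<rightarrow>\<^sub>E Y"
  shows "fun_of E X (graph_of E X f) = f"
proof -
  have "E (graph_of E X f) = (\<lambda>x. opair E x (f x)) ` X"
    using assms(3) by (intro E_graph_of[OF assms(1,2)]) auto
  then show ?thesis
    using assms(3) by (auto simp: fun_of_def opair_inject image_iff PiE_def extensional_def fun_eq_iff)
qed

text \<open>Graphs are subsets of the product, hence members of its power set.\<close>

lemma small_graphs:
  assumes "small E X" "small E Y"
  shows "small E (graph_of E X ` (X \<rightarrow>\<^sub>E Y))"
proof (rule separation)
  show "small E {g. E g \<subseteq> oprod E X Y}"
    by (intro power_set small_oprod assms)
  have "E (graph_of E X f) \<subseteq> oprod E X Y" if "f \<in> X \<rightarrow>\<^sub>E Y" for f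
    using that by (subst E_graph_of[OF assms]) (auto simp: oprod_def)
  then show "graph_of E X ` (X \<rightarrow>\<^sub>E Y) \<subseteq> {g. E g \<subseteq> oprod E X Y}"
    by blast
qed

lemma ofst_oprod: "ofst E \<in> oprod E X Y \<rightarrow> X"
  and osnd_oprod: "osnd E \<in> oprod E X Y \<rightarrow> Y"
  and opair_oprod: "x \<in> X \<Longrightarrow> y \<in> Y \<Longrightarrow> opair E x y \<in> oprod E X Y"
  by (auto simp: oprod_def)

end

section \<open>\<open>\<T>\<close>-graphs and their morphisms\<close>

context strict_topological_theory
begin

sublocale U: set_universe "elts T"
  by (rule universe)

lemma T_morphism_cong:
  assumes "small (elts T) (tpts A)" "small (elts T) (tpts B)" "\<And>x. x \<in> tpts A \<Longrightarrow> f x = g x"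
  shows "T_morphism T A B f \<longleftrightarrow> T_morphism T A B g"
proof -
  have "T_morphism T A B f \<Longrightarrow> T_morphism T A B g"
    if "\<And>x. x \<in> tpts A \<Longrightarrow> f x = g x" for f g
    using that Tmap_cong[OF assms(1,2), of f g] by (auto simp: T_morphism_def Pi_iff)
  from this[of f g, OF assms(3)] this[of g f, OF assms(3)[symmetric]] show ?thesis
    by blast
qed

lemma T_morphism_id: "small (elts T) (tpts A) \<Longrightarrow> T_morphism T A A (\<lambda>x. x)"
  by (simp add: T_morphism_def Tmap_id)

lemma T_morphism_comp:
  assumes "small (elts T) (tpts A)" "small (elts T) (tpts B)" "small (elts T) (tpts C)"
    and f: "T_morphism T A B f" and g: "T_morphism T B C g"
  shows "T_morphism T A C (\<lambda>x. g (f x))"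
proof -
  have fAB: "f \<in> tpts A \<rightarrow> tpts B" and gBC: "g \<in> tpts B \<rightarrow> tpts C"
    using f g by (auto simp: T_morphism_def)
  have "tstr A \<xx> x \<le> tstr C (Tmap T (tpts A) (tpts C) (\<lambda>x. g (f x)) \<xx>) (g (f x))"
    if "\<xx> \<in> Tob T (tpts A)" "x \<in> tpts A" for \<xx> x
  proof -
    have "tstr A \<xx> x \<le> tstr B (Tmap T (tpts A) (tpts B) f \<xx>) (f x)"
      using f that by (simp add: T_morphism_def)
    also have "\<dots> \<le> tstr C (Tmap T (tpts B) (tpts C) g (Tmap T (tpts A) (tpts B) f \<xx>)) (g (f x))"
      using g that Pi_mem[OF fAB] Pi_mem[OF Tmap_funcset[OF assms(1,2) fAB]]
      by (simp add: T_morphism_def)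
    finally show ?thesis
      using that by (simp add: Tmap_comp[OF assms(1-3) fAB gBC])
  qed
  then show ?thesis
    using fAB gBC by (auto simp: T_morphism_def)
qed

section \<open>The algebra structure of V acting on V-valued functions\<close>

lemma val_emb [simp]: "val T (emb T v) = v"
  by (simp add: val_def emb_inj)

lemma emb_val [simp]: "v \<in> Vset T \<Longrightarrow> emb T (val T v) = v"
  by (auto simp: Vset_def)

lemma emb_Vset [simp]: "emb T v \<in> Vset T"
  by (simp add: Vset_def)

lemma xi_Tunit:
  assumes "v \<in> Vset T"
  shows "xi T (Tunit T (Vset T) v) = val T v"
proof -
  have "emb T (xi T (Tunit T (Vset T) v)) = v"
    using xi_algebra assms by (simp add: T_algebra_def)
  then show ?thesis
    using val_emb by metis
qed

lemma xi_on_cong: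
  assumes "small (elts T) X" "\<And>x. x \<in> X \<Longrightarrow> \<phi> x = \<psi> x" "t \<in> Tob T X"
  shows "xi_on T X \<phi> t = xi_on T X \<psi> t"
  using assms by (auto intro!: order.antisym xi_mono)

text \<open>Naturality of the unit moves it to V, where the unit law of the algebra cancels it
  against \<open>xi\<close>.\<close>

lemma xi_on_Tunit:
  assumes "small (elts T) X" "x \<in> X"
  shows "xi_on T X \<phi> (Tunit T X x) = \<phi> x"
  using assms by (simp add: xi_on_def Tunit_natural[OF _ Vset_small] xi_Tunit)

lemma xi_on_Tmap:
  assumes "small (elts T) X" "small (elts T) Y" "f \<in> X \<rightarrow> Y" "t \<in> Tob T X"
  shows "xi_on T Y \<phi> (Tmap T X Y f t) = xi_on T X (\<lambda>x. \<phi> (f x)) t"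
  unfolding xi_on_def
  by (subst Tmap_comp[OF assms(1,2) Vset_small assms(3) _ assms(4), of "\<lambda>y. emb T (\<phi> y)"]) auto

lemma xi_on_val:
  assumes "small (elts T) X" "f \<in> X \<rightarrow> Vset T" "t \<in> Tob T X"
  shows "xi_on T X (\<lambda>x. val T (f x)) t = xi T (Tmap T X (Vset T) f t)"
proof -
  have "Tmap T X (Vset T) (\<lambda>x. emb T (val T (f x))) t = Tmap T X (Vset T) f t"
    using assms(2) by (intro Tmap_cong[OF assms(1) Vset_small _ _ assms(3)]) (auto simp: Pi_iff)
  then show ?thesis
    by (simp add: xi_on_def)
qed

text \<open>The homomorphism axiom for \<otimes> only speaks of the set of pairs of elements of V.
  The pairing of \<phi> and \<psi> carries \<open>t\<close> there, and its two projections give back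
  \<phi> and \<psi>.\<close>

lemma xi_on_mult:
  assumes X: "small (elts T) X" and t: "t \<in> Tob T X"
  shows "xi_on T X (\<lambda>x. \<phi> x * \<psi> x) t = xi_on T X \<phi> t * xi_on T X \<psi> t"
proof -
  let ?E = "elts T" and ?V = "Vset T"
  let ?P = "oprod ?E ?V ?V" and ?g = "\<lambda>x. opair ?E (emb T (\<phi> x)) (emb T (\<psi> x))"
  let ?w = "Tmap T X ?P ?g t"
  have P: "small ?E ?P"
    by (intro U.small_oprod Vset_small)
  have g: "?g \<in> X \<rightarrow> ?P"
    by (auto intro: U.opair_oprod)
  have w: "?w \<in> Tob T ?P"
    using Tmap_funcset[OF X P g] t by auto
  have "xi_on T ?P (\<lambda>p. val T (ofst ?E p) * val T (osnd ?E p)) ?w = xi_on T X (\<lambda>x. \<phi> x * \<psi> x) t"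
    by (subst xi_on_Tmap[OF X P g t]) simp
  moreover have "xi T (Tmap T ?P ?V (ofst ?E) ?w) = xi_on T X \<phi> t"
    by (simp add: xi_on_val[OF P U.ofst_oprod w, symmetric] xi_on_Tmap[OF X P g t])
  moreover have "xi T (Tmap T ?P ?V (osnd ?E) ?w) = xi_on T X \<psi> t"
    by (simp add: xi_on_val[OF P U.osnd_oprod w, symmetric] xi_on_Tmap[OF X P g t])
  ultimately show ?thesis
    using xi_mult[OF w] by simp
qed

text \<open>\<open>xi_on T X \<phi>\<close> is the homomorphic extension of \<phi> to the free
  algebra TX: naturality of the multiplication moves the problem to TTV, where it is the
  associativity law of \<open>xi\<close>.\<close>

lemma xi_on_Tmult:
  assumes X: "small (elts T) X" and t: "t \<in> Tob T (Tob T X)"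
  shows "xi_on T X \<phi> (Tmult T X t) = xi_on T (Tob T X) (xi_on T X \<phi>) t"
proof -
  let ?V = "Vset T" and ?f = "\<lambda>x. emb T (\<phi> x)" and ?\<alpha> = "\<lambda>t. emb T (xi T t)"
  have f: "?f \<in> X \<rightarrow> ?V"
    by simp
  note TX = Tob_small[OF X] and TV = Tob_small[OF Vset_small]
  note Tf = Tmap_funcset[OF X Vset_small f]
  define s where "s = Tmap T (Tob T X) (Tob T ?V) (Tmap T X ?V ?f) t"
  have s: "s \<in> Tob T (Tob T ?V)"
    using Tmap_funcset[OF TX TV Tf] t by (auto simp: s_def)
  have "xi_on T X \<phi> (Tmult T X t) = xi T (Tmult T ?V s)"
    by (simp add: xi_on_def Tmult_natural[OF X Vset_small f t] s_def)
  also have "\<dots> = xi T (Tmap T (Tob T ?V) ?V ?\<alpha> s)"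
    using xi_algebra s emb_inj by (simp add: T_algebra_def inj_eq)
  also have "\<dots> = xi_on T (Tob T ?V) (xi T) s"
    by (simp add: xi_on_def)
  also have "\<dots> = xi_on T (Tob T X) (xi_on T X \<phi>) t"
    unfolding s_def by (subst xi_on_Tmap[OF TX TV Tf t]) (simp add: xi_on_def[abs_def])
  finally show ?thesis .
qed

text \<open>This is the transitivity axiom of a \<T>-category at e(e(x)) and e(y), combined with the
  unit law m(e(e(x))) = e(x).\<close>

lemma T_category_underlying_trans:
  assumes A: "T_category T A" and pts: "x \<in> tpts A" "y \<in> tpts A" "z \<in> tpts A"
  shows "vhom (underlying T A) x y * vhom (underlying T A) y z \<le> vhom (underlying T A) x z"
proof -
  let ?X = "tpts A" and ?E = "elts T"
  let ?e = "Tunit T ?X" and ?P = "oprod ?E (Tob T ?X) ?X"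
  have X: "small ?E ?X"
    using A by (auto simp: T_category_def T_graph_def)
  note TX = Tob_small[OF X] and P = U.small_oprod[OF Tob_small[OF X] X]
  have e: "?e x \<in> Tob T ?X" "?e y \<in> Tob T ?X"
    using Tunit_funcset[OF X] pts by auto
  have ee: "Tunit T (Tob T ?X) (?e x) \<in> Tob T (Tob T ?X)"
    using Tunit_funcset[OF TX] e by auto
  \<comment> \<open>The unit at this pair is the witness for the supremum in \<open>T_ext\<close>:
    by naturality its projections are e(e(x)) and e(y).\<close>
  let ?p = "opair ?E (?e x) y"
  have p: "?p \<in> ?P"
    using e pts by (intro U.opair_oprod)
  have "tstr A (?e x) y = xi_on T ?P (\<lambda>p. tstr A (ofst ?E p) (osnd ?E p)) (Tunit T ?P ?p)"
    by (simp add: xi_on_Tunit[OF P p])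
  also have "\<dots> \<le> T_ext T (Tob T ?X) ?X (tstr A) (Tunit T (Tob T ?X) (?e x)) (?e y)"
    unfolding T_ext_def using Tunit_funcset[OF P] p
    by (intro SUP_upper)
      (auto simp: Tunit_natural[OF P TX U.ofst_oprod p] Tunit_natural[OF P X U.osnd_oprod p])
  finally have "tstr A (?e x) y * tstr A (?e y) z \<le>
      T_ext T (Tob T ?X) ?X (tstr A) (Tunit T (Tob T ?X) (?e x)) (?e y) * tstr A (?e y) z"
    by (intro qmult_mono2) auto
  also have "\<dots> \<le> tstr A (Tmult T ?X (Tunit T (Tob T ?X) (?e x))) z"
    using A ee e pts by (auto simp: T_category_def)
  finally show ?thesis
    using e by (simp add: underlying_def Tmult_Tunit[OF X])
qed

end

section \<open>Initial structures\<close>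

text \<open>The largest structure for which every \<phi> j is a morphism into V. The maps \<phi> j
  take values in the quantale itself, so no embedding into the universe appears in the
  formula.\<close>

definition initial_graph ::
  "('u, 'v::comm_quantale) top_theory \<Rightarrow> 'u set \<Rightarrow> 'j set \<Rightarrow> ('j \<Rightarrow> 'u \<Rightarrow> 'v) \<Rightarrow> ('u, 'v) tgraph"
where
  "initial_graph T X J \<phi> =
     \<lparr>tpts = X, tstr = (\<lambda>\<xx> x. INF j\<in>J. qhom (xi_on T X (\<phi> j) \<xx>) (\<phi> j x))\<rparr>"

lemma tpts_initial_graph [simp]: "tpts (initial_graph T X J \<phi>) = X"
  by (simp add: initial_graph_def)

context strict_topological_theory
begin

text \<open>At a unit, \<open>xi_on\<close> returns the plain value \<phi> j x, so the structure
  reduces to a pointwise comparison. This identifies the order underlying the space of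
  points.\<close>

lemma le_initial_graph_Tunit_iff:
  assumes "small (elts T) X" "x \<in> X"
  shows "1 \<le> tstr (initial_graph T X J \<phi>) (Tunit T X x) y \<longleftrightarrow> (\<forall>j\<in>J. \<phi> j x \<le> \<phi> j y)"
  by (simp add: initial_graph_def xi_on_Tunit[OF assms] le_INF_iff one_le_qhom_iff)

lemma T_category_initial_graph:
  assumes X: "small (elts T) X"
  shows "T_category T (initial_graph T X J \<phi>)"
proof -
  let ?E = "elts T" and ?a = "tstr (initial_graph T X J \<phi>)"
  let ?P = "oprod ?E (Tob T X) X" and ?r = "\<lambda>p. ?a (ofst (elts T) p) (osnd (elts T) p)"
  note TX = Tob_small[OF X] and P = U.small_oprod[OF Tob_small[OF X] X]
  have "xi_on T ?P ?r w * ?a \<yy> x \<le> qhom (xi_on T X (\<phi> j) (Tmult T X \<XX>)) (\<phi> j x)"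
    if \<XX>: "\<XX> \<in> Tob T (Tob T X)" and j: "j \<in> J" and w: "w \<in> Tob T ?P"
      and w1: "Tmap T ?P (Tob T X) (ofst ?E) w = \<XX>" and w2: "Tmap T ?P X (osnd ?E) w = \<yy>"
    for \<XX> \<yy> x j w
  proof -
    \<comment> \<open>As \<XX> is the first projection of \<open>w\<close>, both factors become
      values of \<open>xi_on\<close> at the same \<open>w\<close>. Multiplicativity then merges
      them, leaving an inequality that holds pointwise by definition of the structure.\<close>
    have "xi_on T X (\<phi> j) (Tmult T X \<XX>) * xi_on T ?P ?r w =
        xi_on T ?P (\<lambda>p. xi_on T X (\<phi> j) (ofst ?E p)) w * xi_on T ?P ?r w"
      using xi_on_Tmap[OF P TX U.ofst_oprod w, of "xi_on T X (\<phi> j)"]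
      by (simp add: xi_on_Tmult[OF X \<XX>] w1)
    also have "\<dots> = xi_on T ?P (\<lambda>p. xi_on T X (\<phi> j) (ofst ?E p) * ?r p) w"
      by (rule xi_on_mult[OF P w, symmetric])
    also have "\<dots> \<le> xi_on T ?P (\<lambda>p. \<phi> j (osnd ?E p)) w"
      using j by (intro xi_mono[OF P _ w])
        (auto simp: initial_graph_def le_qhom_iff'[symmetric] intro: INF_lower)
    also have "\<dots> = xi_on T X (\<phi> j) \<yy>"
      by (simp add: w2[symmetric] xi_on_Tmap[OF P X U.osnd_oprod w])
    finally have le: "xi_on T X (\<phi> j) (Tmult T X \<XX>) * xi_on T ?P ?r w \<le> xi_on T X (\<phi> j) \<yy>" .
    have "xi_on T X (\<phi> j) (Tmult T X \<XX>) * (xi_on T ?P ?r w * ?a \<yy> x) =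
        xi_on T X (\<phi> j) (Tmult T X \<XX>) * xi_on T ?P ?r w * ?a \<yy> x"
      by (simp add: mult.assoc)
    also have "\<dots> \<le> xi_on T X (\<phi> j) \<yy> * qhom (xi_on T X (\<phi> j) \<yy>) (\<phi> j x)"
      using j by (intro qmult_mono2 le) (auto simp: initial_graph_def intro: INF_lower)
    also have "\<dots> \<le> \<phi> j x"
      by (rule qhom_mult_le)
    finally show ?thesis
      by (simp add: le_qhom_iff')
  qed
  \<comment> \<open>\<otimes> preserves suprema, so it is enough to bound the contribution of each
    \<open>w\<close> in \<open>T_ext\<close> and each index j.\<close>
  then have "T_ext T (Tob T X) X ?a \<XX> \<yy> * ?a \<yy> x \<le> ?a (Tmult T X \<XX>) x"
    if "\<XX> \<in> Tob T (Tob T X)" for \<XX> \<yy> x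
    using that
    by (auto simp: T_ext_def SUP_mult_le_iff initial_graph_def[of T X J \<phi>] le_INF_iff)
  moreover have "T_graph T (initial_graph T X J \<phi>)"
    using X by (simp add: T_graph_def le_initial_graph_Tunit_iff)
  ultimately show ?thesis
    by (simp add: T_category_def)
qed

text \<open>Each coordinate of the target, composed with \<open>f\<close>, is a coordinate of the
  source; hence the infimum for the source lies below every term of the one for the target.\<close>

lemma T_morphism_initial_graph:
  assumes X: "small (elts T) X" and Y: "small (elts T) Y" and f: "f \<in> X \<rightarrow> Y" and g: "g \<in> K \<rightarrow> J"
    and eq: "\<And>k x. k \<in> K \<Longrightarrow> x \<in> X \<Longrightarrow> \<psi> k (f x) = \<phi> (g k) x"
  shows "T_morphism T (initial_graph T X J \<phi>) (initial_graph T Y K \<psi>) f"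
proof -
  have "(INF j\<in>J. qhom (xi_on T X (\<phi> j) \<xx>) (\<phi> j x)) \<le>
      qhom (xi_on T Y (\<psi> k) (Tmap T X Y f \<xx>)) (\<psi> k (f x))"
    if "\<xx> \<in> Tob T X" "x \<in> X" "k \<in> K" for \<xx> x k
  proof -
    have "xi_on T Y (\<psi> k) (Tmap T X Y f \<xx>) = xi_on T X (\<phi> (g k)) \<xx>"
      using that eq by (simp add: xi_on_Tmap[OF X Y f] cong: xi_on_cong[OF X])
    then show ?thesis
      using that eq g by (auto intro!: INF_lower2[of "g k"])
  qed
  then show ?thesis
    using f by (simp add: T_morphism_def initial_graph_def le_INF_iff)
qed

end

section \<open>Categories and functors\<close>

lemma is_category_opposite: "is_category C \<Longrightarrow> is_category (opposite C)"
  unfolding is_category_def opposite_def by auto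

lemma is_functor_comp_func:
  assumes "is_functor C D F" "is_functor D K G"
  shows "is_functor C K (comp_func G F)"
  using assms unfolding is_functor_def comp_func_def by simp

text \<open>Allows functoriality of \<open>hom_V\<close> to be deduced from that of the composite
  with which it agrees.\<close>

lemma is_functor_functor_eq:
  assumes "is_functor C D F" "functor_eq C F G"
  shows "is_functor C D G"
proof -
  have C: "is_category C" and eq: "\<And>A. A \<in> Ob C \<Longrightarrow> fob G A = fob F A"
    "\<And>A B f. A \<in> Ob C \<Longrightarrow> B \<in> Ob C \<Longrightarrow> f \<in> Hom C A B \<Longrightarrow> farr G A B f = farr F A B f"
    using assms by (simp_all add: is_functor_def functor_eq_def)
  \<comment> \<open>The agreement of \<open>F\<close> and \<open>G\<close> can be used at identities
    and composites only once these are known to be arrows of \<open>C\<close>.\<close>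
  have "cmp C A B K g f \<in> Hom C A K"
    if "A \<in> Ob C" "B \<in> Ob C" "K \<in> Ob C" "f \<in> Hom C A B" "g \<in> Hom C B K" for A B K f g
    using C that unfolding is_category_def by blast
  moreover have "ident C A \<in> Hom C A A" if "A \<in> Ob C" for A
    using C that unfolding is_category_def by blast
  ultimately show ?thesis
    using assms(1) unfolding is_functor_def by (simp add: eq)
qed

text \<open>For extensional functions the identity and associativity laws hold on the nose, so only
  closure under identities and composition remains to be checked.\<close>

lemma is_category_concrete:
  fixes C :: "('o, 'a \<Rightarrow> 'a) category"
  assumes "\<And>A B f. A \<in> Ob C \<Longrightarrow> B \<in> Ob C \<Longrightarrow> f \<in> Hom C A B \<Longrightarrow> f \<in> carr A \<rightarrow>\<^sub>E carr B"
    and "\<And>A. A \<in> Ob C \<Longrightarrow> ident C A = restrict id (carr A)"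
    and "\<And>A B D f g. A \<in> Ob C \<Longrightarrow> cmp C A B D g f = compose (carr A) g f"
    and "\<And>A. A \<in> Ob C \<Longrightarrow> restrict id (carr A) \<in> Hom C A A"
    and "\<And>A B D f g. A \<in> Ob C \<Longrightarrow> B \<in> Ob C \<Longrightarrow> D \<in> Ob C \<Longrightarrow> f \<in> Hom C A B \<Longrightarrow>
      g \<in> Hom C B D \<Longrightarrow> compose (carr A) g f \<in> Hom C A D"
  shows "is_category C"
proof -
  have id: "compose (carr A) f (restrict id (carr A)) = f" "compose (carr A) (restrict id (carr B)) f = f"
    if "A \<in> Ob C" "B \<in> Ob C" "f \<in> Hom C A B" for A B f
    using assms(1)[OF that] by (auto simp: compose_def fun_eq_iff PiE_def extensional_def)
  have assoc: "compose (carr A) h (compose (carr A) g f) = compose (carr A) (compose (carr B) h g) f"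
    if "A \<in> Ob C" "B \<in> Ob C" "f \<in> Hom C A B" for A B f g h
    using assms(1)[OF that] by (auto simp: compose_def fun_eq_iff)
  show ?thesis
    unfolding is_category_def
    by (intro conjI ballI) (simp_all add: assms(2-5) id assoc)
qed

lemma is_category_Ord_cat: "is_category (Ord_cat E)"
proof (rule is_category_concrete[where carr = fst])
  fix A B D :: "'a set \<times> ('a \<times> 'a) set" and f g
  assume "A \<in> Ob (Ord_cat E)" and f: "f \<in> Hom (Ord_cat E) A B" and g: "g \<in> Hom (Ord_cat E) B D"
  \<comment> \<open>Related elements lie in the carrier, where \<open>compose\<close> is the actual
    composite.\<close>
  then have "snd A \<subseteq> fst A \<times> fst A"
    by (auto simp: Ord_cat_def preorder_on_def)
  moreover have "f \<in> fst A \<rightarrow> fst B" "g \<in> fst B \<rightarrow> fst D"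
    "\<And>x y. (x, y) \<in> snd A \<Longrightarrow> (f x, f y) \<in> snd B" "\<And>x y. (x, y) \<in> snd B \<Longrightarrow> (g x, g y) \<in> snd D"
    using f g by (auto simp: Ord_cat_def split: prod.splits)
  ultimately have "compose (fst A) g f \<in> fst A \<rightarrow>\<^sub>E fst D"
    "\<forall>(x, y)\<in>snd A. (compose (fst A) g f x, compose (fst A) g f y) \<in> snd D"
    by (auto simp: compose_def)
  then show "compose (fst A) g f \<in> Hom (Ord_cat E) A D"
    by (cases A; cases D) (simp add: Ord_cat_def)
qed (auto simp: Ord_cat_def preorder_on_def refl_on_def)

context strict_topological_theory
begin

section \<open>\<T>-categories and their underlying preorders\<close>

lemma T_category_small: "T_category T A \<Longrightarrow> small (elts T) (tpts A)"
  by (simp add: T_category_def T_graph_def)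

lemma T_morphism_restrict_id:
  assumes "small (elts T) (tpts A)"
  shows "T_morphism T A A (restrict id (tpts A))"
  using T_morphism_id[OF assms] T_morphism_cong[OF assms assms, of "\<lambda>x. x" "restrict id (tpts A)"]
  by simp

lemma T_morphism_compose:
  assumes "small (elts T) (tpts A)" "small (elts T) (tpts B)" "small (elts T) (tpts C)"
    and "T_morphism T A B f" "T_morphism T B C g"
  shows "T_morphism T A C (compose (tpts A) g f)"
  using T_morphism_comp[OF assms]
    T_morphism_cong[OF assms(1,3), of "\<lambda>x. g (f x)" "compose (tpts A) g f"]
  by (simp add: compose_def)

lemma is_category_TCat: "is_category (TCat T)"
proof (rule is_category_concrete[where carr = tpts])
  fix A assume "A \<in> Ob (TCat T)"
  then show "restrict id (tpts A) \<in> Hom (TCat T) A A"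
    by (auto simp: TCat_def T_morphism_restrict_id T_category_small)
next
  fix A B D f g
  assume "A \<in> Ob (TCat T)" "B \<in> Ob (TCat T)" "D \<in> Ob (TCat T)"
    "f \<in> Hom (TCat T) A B" "g \<in> Hom (TCat T) B D"
  then show "compose (tpts A) g f \<in> Hom (TCat T) A D"
    using T_morphism_compose[of A B D f g] T_category_small
    by (auto simp: TCat_def compose_def PiE_def Pi_iff)
qed (auto simp: TCat_def)

lemma is_functor_forgetful: "is_functor (TCat T) (Ord_cat (elts T)) (forgetful T)"
proof -
  have order: "preorder_on (tpts A) {(x', x). x' \<in> tpts A \<and> x \<in> tpts A \<and> 1 \<le> tstr A (Tunit T (tpts A) x') x}"
    if A: "T_category T A" for A
  proof -
    have "1 \<le> tstr A (Tunit T (tpts A) x) z"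
      if "x \<in> tpts A" "y \<in> tpts A" "z \<in> tpts A"
        "1 \<le> tstr A (Tunit T (tpts A) x) y" "1 \<le> tstr A (Tunit T (tpts A) y) z" for x y z
      using order_trans[OF qmult_mono2[OF that(4,5)]] T_category_underlying_trans[OF A that(1-3)]
      by (simp add: underlying_def)
    moreover have "1 \<le> tstr A (Tunit T (tpts A) x) x" if "x \<in> tpts A" for x
      using A that by (simp add: T_category_def T_graph_def)
    ultimately show ?thesis
      unfolding preorder_on_def refl_on_def trans_def by blast
  qed
  \<comment> \<open>The morphism condition is evaluated at e(x), which naturality of the unit sends
    to e(f(x)).\<close>
  have mono: "1 \<le> tstr B (Tunit T (tpts B) (f x)) (f y)"
    if "T_category T A" "T_category T B" "T_morphism T A B f"
      "x \<in> tpts A" "y \<in> tpts A" "1 \<le> tstr A (Tunit T (tpts A) x) y" for A B f x y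
  proof -
    have A: "small (elts T) (tpts A)" and B: "small (elts T) (tpts B)" and f: "f \<in> tpts A \<rightarrow> tpts B"
      using that by (auto simp: T_category_small T_morphism_def)
    have "Tunit T (tpts A) x \<in> Tob T (tpts A)"
      using Tunit_funcset[OF A] that by auto
    then have "tstr A (Tunit T (tpts A) x) y \<le>
        tstr B (Tmap T (tpts A) (tpts B) f (Tunit T (tpts A) x)) (f y)"
      using that by (simp add: T_morphism_def)
    with that(6) show ?thesis
      by (simp add: Tunit_natural[OF A B f that(4)])
  qed
  have "f \<in> Hom (Ord_cat (elts T)) (fob (forgetful T) A) (fob (forgetful T) B)"
    if A: "T_category T A" and B: "T_category T B" and f: "f \<in> Hom (TCat T) A B" for A B f
  proof -
    have "T_morphism T A B f" "f \<in> tpts A \<rightarrow>\<^sub>E tpts B"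
      using f by (auto simp: TCat_def)
    then show ?thesis
      using mono[OF A B] by (auto simp: Ord_cat_def forgetful_def)
  qed
  moreover have "fob (forgetful T) A \<in> Ob (Ord_cat (elts T))" if "T_category T A" for A
    using order[OF that] T_category_small[OF that] by (simp add: Ord_cat_def forgetful_def)
  moreover have "Ob (TCat T) = {A. T_category T A}" "farr (forgetful T) = (\<lambda>A B f. f)"
    "ident (TCat T) A = ident (Ord_cat (elts T)) (fob (forgetful T) A)"
    "cmp (TCat T) A B K =
      cmp (Ord_cat (elts T)) (fob (forgetful T) A) (fob (forgetful T) B) (fob (forgetful T) K)"
    for A B K
    by (simp_all add: TCat_def Ord_cat_def forgetful_def)
  ultimately show ?thesis
    by (simp add: is_functor_def is_category_TCat is_category_Ord_cat)
qed

end

section \<open>The frame \<open>V\<close>\<close>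

context strict_topological_theory
begin

lemma tpts_V_graph [simp]: "tpts (V_graph T) = Vset T"
  by (simp add: V_graph_def)

lemma vhom_V_graph:
  "v \<in> Vset T \<Longrightarrow> vhom (underlying T (V_graph T)) v w = qhom (val T v) (val T w)"
  by (simp add: underlying_def V_graph_def xi_Tunit)

lemma T_graph_V_graph: "T_graph T (V_graph T)"
  by (simp add: T_graph_def Vset_small) (simp add: V_graph_def xi_Tunit one_le_qhom_iff)

lemma V_category_V_graph: "V_category (underlying T (V_graph T))"
proof -
  have "x * (qhom x y * qhom y z) \<le> z" for x y z :: 'v
    using qmult_mono2[OF qhom_mult_le[of x y] order_refl, of "qhom y z"] qhom_mult_le[of y z]
    by (simp add: mult.assoc)
  then show ?thesis
    by (auto simp: V_category_def vhom_V_graph one_le_qhom_iff le_qhom_iff')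
qed

text \<open>\<open>qhom\<close> preserves infima in its second argument, and two applications of
  \<open>qhom\<close> commute, which gives the universal property of the infimum.\<close>

lemma is_limit_V_graphI:
  assumes "h \<in> vpts I \<rightarrow> Vset T" "c \<in> Vset T"
    and "val T c = (INF i\<in>vpts I. qhom (\<phi> i) (val T (h i)))"
  shows "is_limit (underlying T (V_graph T)) I \<phi> h c"
  using assms by (auto simp: is_limit_def vhom_V_graph qhom_INF intro!: INF_cong qhom_left_commute)

lemma V_complete_V_graph: "V_complete T (underlying T (V_graph T))"
  unfolding V_complete_def V_functor_def
  \<comment> \<open>Unification with \<open>val_emb\<close> chooses the limit as the embedded
    infimum.\<close>
  by (intro allI impI exI, rule is_limit_V_graphI[OF _ emb_Vset val_emb]) auto

lemma is_sup_V_graph: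
  assumes \<phi>: "\<phi> \<in> vpts (presheaves (underlying T (V_graph T)))"
    and c: "is_sup (underlying T (V_graph T)) \<phi> c"
  shows "val T c = \<phi> (emb T 1)"
proof -
  have cV: "c \<in> Vset T"
    using c by (simp add: is_sup_def)
  \<comment> \<open>Every \<open>v\<close> of the quantale is tested through the point
    \<open>emb T v\<close>.\<close>
  have hom_c: "qhom (val T c) v = (INF x\<in>Vset T. qhom (\<phi> x) (qhom (val T x) v))" for v
    using c cV by (auto simp: is_sup_def vhom_V_graph dest!: bspec[of _ _ "emb T v"])
  \<comment> \<open>Since hom(k,x) = x, the distributor law at the unit bounds x \<otimes> \<phi>(x)
    by \<phi>(k).\<close>
  have "\<forall>x\<in>Vset T. vhom (underlying T (V_graph T)) (emb T 1) x * \<phi> x \<le> \<phi> (emb T 1)"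
    using \<phi> by (simp add: presheaves_def distributor_from_one_def)
  then have "val T x * \<phi> x \<le> \<phi> (emb T 1)" if "x \<in> Vset T" for x
    using that by (simp add: vhom_V_graph)
  then have "1 \<le> qhom (val T c) (\<phi> (emb T 1))"
    by (simp add: hom_c le_INF_iff le_qhom_iff mult.commute)
  moreover have "1 \<le> qhom (\<phi> (emb T 1)) (val T c)"
  proof -
    have "1 \<le> qhom (val T c) (val T c)"
      by (simp add: one_le_qhom_iff)
    also have "\<dots> \<le> qhom (\<phi> (emb T 1)) (qhom (val T (emb T 1)) (val T c))"
      \<comment> \<open>The term of the infimum at \<open>emb T 1\<close> is selected.\<close>
      unfolding hom_c[of "val T c"] by (rule INF_lower) simp
    finally show ?thesis
      by simp
  qed
  ultimately show ?thesis
    by (simp add: one_le_qhom_iff)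
qed

lemma T_frame_V_graph: "T_frame T (V_graph T)"
proof -
  let ?V = "underlying T (V_graph T)"
  have "is_limit ?V I \<phi> s c"
    if h: "V_functor I (presheaves ?V) h" and l: "is_limit (presheaves ?V) I \<phi> h l"
      and s: "\<forall>i\<in>vpts I. is_sup ?V (h i) (s i)" and c: "is_sup ?V l c"
    for I :: "('u, 'v) vgraph" and \<phi> h l s c
  proof (rule is_limit_V_graphI)
    have h': "h \<in> vpts I \<rightarrow> vpts (presheaves ?V)"
      using h by (simp add: V_functor_def)
    have "l \<in> vpts (presheaves ?V)"
      using l by (simp add: is_limit_def)
    then have "val T c = l (emb T 1)"
      using c by (rule is_sup_V_graph)
    also have "\<dots> = (INF i\<in>vpts I. qhom (\<phi> i) (h i (emb T 1)))"
      by (rule limit_presheaves_pointwise[OF V_category_V_graph _ h' l]) simp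
    also have "\<dots> = (INF i\<in>vpts I. qhom (\<phi> i) (val T (s i)))"
      using h' s by (intro INF_cong refl) (metis PiE is_sup_V_graph)
    finally show "val T c = (INF i\<in>vpts I. qhom (\<phi> i) (val T (s i)))" .
  qed (use s c in \<open>auto simp: is_sup_def\<close>)
  then show ?thesis
    using T_graph_V_graph V_category_V_graph V_complete_V_graph
    unfolding T_frame_def by blast
qed

end

section \<open>Frame homomorphisms\<close>

context strict_topological_theory
begin

lemma T_frame_T_graph: "T_frame T A \<Longrightarrow> T_graph T A"
  by (simp add: T_frame_def)

lemma T_frame_small: "T_frame T A \<Longrightarrow> small (elts T) (tpts A)"
  by (simp add: T_frame_def T_graph_def)

text \<open>All diagrams in the defining conditions take their values in \<open>tpts A\<close>, and
  so do the limits and colimits considered.\<close>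

lemma T_frame_hom_cong_imp:
  assumes A: "small (elts T) (tpts A)" and B: "small (elts T) (tpts B)"
    and eq: "\<And>x. x \<in> tpts A \<Longrightarrow> f x = g x" and f: "T_frame_hom T A B f"
  shows "T_frame_hom T A B g"
proof -
  have "T_morphism T (algebra_graph I \<alpha>) B (\<lambda>i. g (h i))"
    if "T_algebra T I \<alpha>" "T_morphism T (algebra_graph I \<alpha>) A h" for I \<alpha> h
  proof -
    have "T_morphism T (algebra_graph I \<alpha>) B (\<lambda>i. f (h i))"
      using f that by (auto simp: T_frame_hom_def T_compatible_def)
    moreover have "h \<in> I \<rightarrow> tpts A" "small (elts T) I"
      using that by (auto simp: T_morphism_def algebra_graph_def T_algebra_def)
    ultimately show ?thesis
      using T_morphism_cong[OF _ B, of "algebra_graph I \<alpha>" "\<lambda>i. f (h i)" "\<lambda>i. g (h i)"] eq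
      by (auto simp: algebra_graph_def Pi_iff)
  qed
  moreover have "is_limit (underlying T B) I \<phi> (\<lambda>i. g (h i)) (g c)"
    if "small (elts T) (vpts I)" "V_category I" "distributor_to_one I \<phi>"
      "V_functor I (underlying T A) h" "is_limit (underlying T A) I \<phi> h c"
    for I :: "('u, 'v) vgraph" and \<phi> h c
  proof -
    have "is_limit (underlying T B) I \<phi> (\<lambda>i. f (h i)) (f c)"
      using f that unfolding T_frame_hom_def preserves_limits_def by blast
    moreover have "h \<in> vpts I \<rightarrow> tpts A" "c \<in> tpts A"
      using that by (auto simp: V_functor_def is_limit_def)
    ultimately show ?thesis
      using is_limit_cong[of I "\<lambda>i. f (h i)" "\<lambda>i. g (h i)" "underlying T B" \<phi>] eq
      by (auto simp: Pi_iff)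
  qed
  moreover have "is_colimit (underlying T B) I \<psi> (\<lambda>i. g (h i)) (g c)"
    if "T_weighted_diagram T A I \<alpha> h \<psi>" "is_colimit (underlying T A) I \<psi> h c"
    for I \<alpha> \<psi> h c
  proof -
    have "is_colimit (underlying T B) I \<psi> (\<lambda>i. f (h i)) (f c)"
      using f that unfolding T_frame_hom_def preserves_T_colimits_def by blast
    moreover have "h \<in> vpts I \<rightarrow> tpts A" "c \<in> tpts A"
      using that by (auto simp: V_functor_def is_colimit_def T_weighted_diagram_def)
    ultimately show ?thesis
      using is_colimit_cong[of I "\<lambda>i. f (h i)" "\<lambda>i. g (h i)" "underlying T B" \<psi>] eq
      by (auto simp: Pi_iff)
  qed
  moreover have "V_functor (underlying T A) (underlying T B) g"
    using f eq V_functor_cong[of "underlying T A" f g "underlying T B"]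
    by (simp add: T_frame_hom_def)
  ultimately show ?thesis
    unfolding T_frame_hom_def T_compatible_def preserves_limits_def preserves_T_colimits_def
    by blast
qed

lemma T_frame_hom_id: "T_frame_hom T A A (\<lambda>x. x)"
  by (auto simp: T_frame_hom_def V_functor_def T_compatible_def preserves_limits_def
      preserves_T_colimits_def)

text \<open>By T1 = 1 the only element of \<open>Tob T {z}\<close> is the unit at \<open>z\<close>,
  so the condition is just reflexivity of \<open>A\<close> at \<open>x\<close>.\<close>

lemma T_morphism_from_one_point:
  assumes "T_one T" and A: "T_graph T A" and x: "x \<in> tpts A"
  shows "T_morphism T (algebra_graph {z} (\<lambda>_. z)) A (\<lambda>_. x)"
proof -
  have "tt = Tunit T {z} z" if "tt \<in> Tob T {z}" for tt
    using assms(1) that Tunit_funcset[OF U.small_singleton, of z]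
    by (metis PiE T_one_def insertI1 is_singleton_def singletonD)
  moreover have "Tmap T {z} (tpts A) (\<lambda>_. x) (Tunit T {z} z) = Tunit T (tpts A) x"
    using A x by (intro Tunit_natural[OF U.small_singleton]) (auto simp: T_graph_def)
  ultimately show ?thesis
    using A x by (auto simp: T_morphism_def algebra_graph_def T_graph_def)
qed

lemma T_frame_hom_tensor:
  assumes "T_one T" and A: "T_graph T A" and f: "T_frame_hom T A B f"
    and x: "x \<in> tpts A" and t: "is_tensor (underlying T A) v x t"
  shows "is_tensor (underlying T B) v (f x) (f t)"
proof -
  \<comment> \<open>The one-point V-category with hom-object k, for which any \<open>v\<close> is a
    distributor; the tensor is the colimit of the constant diagram with weight
    \<open>v\<close>.\<close>
  define I :: "('u, 'v) vgraph" where "I = \<lparr>vpts = {x}, vhom = (\<lambda>_ _. 1)\<rparr>"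
  have "T_algebra T {x} (\<lambda>_. x)"
    by (auto simp: T_algebra_def U.small_singleton)
  moreover have "V_category I" "V_functor I (underlying T A) (\<lambda>_. x)"
    "distributor_from_one I (\<lambda>_. v)"
    using A x by (auto simp: I_def V_category_def V_functor_def distributor_from_one_def
        underlying_def T_graph_def)
  moreover have "T_morphism T (algebra_graph {x} (\<lambda>_. x)) A (\<lambda>_. t)"
    using t by (intro T_morphism_from_one_point assms(1) A) (simp add: is_tensor_def)
  ultimately have "T_weighted_diagram T A I (\<lambda>_. x) (\<lambda>_. x) (\<lambda>_. v)"
    using t by (auto simp: T_weighted_diagram_def I_def)
  moreover have "is_colimit (underlying T A) I (\<lambda>_. v) (\<lambda>_. x) t"
    using t by (simp add: is_colimit_def is_tensor_def I_def)
  ultimately have "is_colimit (underlying T B) I (\<lambda>_. v) (\<lambda>_. f x) (f t)"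
    using f unfolding T_frame_hom_def preserves_T_colimits_def by blast
  then show ?thesis
    by (simp add: is_colimit_def is_tensor_def I_def)
qed

text \<open>Preservation of tensors makes the images of the chosen tensors tensors again, and
  compatibility keeps them a morphism on the algebra.\<close>

lemma T_weighted_diagram_image:
  assumes "T_one T" and A: "T_graph T A" and f: "T_frame_hom T A B f"
    and d: "T_weighted_diagram T A I \<alpha> h \<psi>"
  shows "T_weighted_diagram T B I \<alpha> (\<lambda>i. f (h i)) \<psi>"
proof -
  from d obtain t where t: "\<forall>i\<in>vpts I. is_tensor (underlying T A) (\<psi> i) (h i) (t i)"
    and tm: "T_morphism T (algebra_graph (vpts I) \<alpha>) A t"
    by (auto simp: T_weighted_diagram_def)
  have h: "h \<in> vpts I \<rightarrow> tpts A"
    using d by (simp add: T_weighted_diagram_def V_functor_def)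
  have "\<forall>i\<in>vpts I. is_tensor (underlying T B) (\<psi> i) (f (h i)) (f (t i))"
    using t h T_frame_hom_tensor[OF assms(1) A f] by (blast dest: Pi_mem)
  moreover have "T_morphism T (algebra_graph (vpts I) \<alpha>) B (\<lambda>i. f (t i))"
    using f d tm by (auto simp: T_frame_hom_def T_compatible_def T_weighted_diagram_def)
  ultimately show ?thesis
    using d f V_functor_comp[of I "underlying T A" h "underlying T B" f]
    by (auto simp: T_weighted_diagram_def T_frame_hom_def)
qed

text \<open>The delicate condition is the one on colimits: \<open>g\<close> preserves those of
  \<T>-weighted diagrams, so the image of the diagram under \<open>f\<close> must again be
  \<T>-weighted. This is where T1 = 1 enters.\<close>

lemma T_frame_hom_comp:
  assumes "T_one T" and A: "T_graph T A"
    and f: "T_frame_hom T A B f" and g: "T_frame_hom T B C g"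
  shows "T_frame_hom T A C (\<lambda>x. g (f x))"
proof -
  have Vf: "V_functor (underlying T A) (underlying T B) f"
    and Vg: "V_functor (underlying T B) (underlying T C) g"
    using f g by (auto simp: T_frame_hom_def)
  have "T_compatible T A C (\<lambda>x. g (f x))"
    unfolding T_compatible_def
  proof (intro allI impI, elim conjE)
    fix I \<alpha> h
    assume I: "T_algebra T I \<alpha>" and h: "T_morphism T (algebra_graph I \<alpha>) A h"
    have "T_morphism T (algebra_graph I \<alpha>) B (\<lambda>i. f (h i))"
      using f I h unfolding T_frame_hom_def T_compatible_def by blast
    then show "T_morphism T (algebra_graph I \<alpha>) C (\<lambda>i. g (f (h i)))"
      using g I unfolding T_frame_hom_def T_compatible_def by blast
  qed
  moreover have "preserves_limits T (underlying T A) (underlying T C) (\<lambda>x. g (f x))"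
    unfolding preserves_limits_def
  proof (intro allI impI, elim conjE)
    fix I :: "('u, 'v) vgraph" and \<phi> h c
    assume I: "small (elts T) (vpts I)" "V_category I" "distributor_to_one I \<phi>"
      and h: "V_functor I (underlying T A) h" and c: "is_limit (underlying T A) I \<phi> h c"
    have "is_limit (underlying T B) I \<phi> (\<lambda>i. f (h i)) (f c)"
      using f I h c unfolding T_frame_hom_def preserves_limits_def by blast
    then show "is_limit (underlying T C) I \<phi> (\<lambda>i. g (f (h i))) (g (f c))"
      using g I V_functor_comp[OF h Vf] unfolding T_frame_hom_def preserves_limits_def by blast
  qed
  moreover have "preserves_T_colimits T A C (\<lambda>x. g (f x))"
    unfolding preserves_T_colimits_def
  proof (intro allI impI, elim conjE)
    fix I \<alpha> h \<psi> c
    assume d: "T_weighted_diagram T A I \<alpha> h \<psi>" and c: "is_colimit (underlying T A) I \<psi> h c"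
    have "is_colimit (underlying T B) I \<psi> (\<lambda>i. f (h i)) (f c)"
      using f d c unfolding T_frame_hom_def preserves_T_colimits_def by blast
    then show "is_colimit (underlying T C) I \<psi> (\<lambda>i. g (f (h i))) (g (f c))"
      using g T_weighted_diagram_image[OF assms(1) A f d]
      unfolding T_frame_hom_def preserves_T_colimits_def by blast
  qed
  ultimately show ?thesis
    using V_functor_comp[OF Vf Vg] by (simp add: T_frame_hom_def)
qed

lemma is_category_TFrm:
  assumes "T_one T"
  shows "is_category (TFrm T)"
proof (rule is_category_concrete[where carr = tpts])
  fix A assume "A \<in> Ob (TFrm T)"
  then have A: "small (elts T) (tpts A)"
    by (simp add: TFrm_def T_frame_small)
  have "T_frame_hom T A A (restrict id (tpts A))"
    by (rule T_frame_hom_cong_imp[OF A A _ T_frame_hom_id]) simp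
  then show "restrict id (tpts A) \<in> Hom (TFrm T) A A"
    by (auto simp: TFrm_def)
next
  fix A B D f g
  assume "A \<in> Ob (TFrm T)" "D \<in> Ob (TFrm T)"
    and f: "f \<in> Hom (TFrm T) A B" and g: "g \<in> Hom (TFrm T) B D"
  then have A: "T_graph T A" "small (elts T) (tpts A)" and D: "small (elts T) (tpts D)"
    by (simp_all add: TFrm_def T_frame_T_graph T_frame_small)
  have "T_frame_hom T A D (\<lambda>x. g (f x))"
    by (rule T_frame_hom_comp[OF assms A(1), of B]) (use f g in \<open>simp_all add: TFrm_def\<close>)
  then have "T_frame_hom T A D (compose (tpts A) g f)"
    by (rule T_frame_hom_cong_imp[OF A(2) D, rotated]) (simp add: compose_def)
  moreover have "compose (tpts A) g f \<in> tpts A \<rightarrow>\<^sub>E tpts D"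
    using f g by (auto simp: TFrm_def compose_def PiE_def Pi_iff)
  ultimately show "compose (tpts A) g f \<in> Hom (TFrm T) A D"
    by (simp add: TFrm_def)
qed (auto simp: TFrm_def)

end

section \<open>Points\<close>

text \<open>Points are elements of the universe: first the graph is decoded into a function, then
  its value into the quantale.\<close>

definition eval_point :: "('u, 'v) top_theory \<Rightarrow> ('u, 'v) tgraph \<Rightarrow> 'u \<Rightarrow> 'u \<Rightarrow> 'v" where
  "eval_point T A x p = val T (fun_of (elts T) (tpts A) p x)"

text \<open>The forgetful functor is the identity on arrows, so the arrow part of a lift is
  forced.\<close>

definition pt ::
  "('u, 'v::comm_quantale) top_theory \<Rightarrow>
    (('u, 'v) tgraph, 'u \<Rightarrow> 'u, ('u, 'v) tgraph, 'u \<Rightarrow> 'u) func" where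
  "pt T =
     \<lparr>fob = (\<lambda>A. initial_graph T (frame_points T A) (tpts A) (eval_point T A)),
      farr = farr (hom_V T)\<rparr>"

context strict_topological_theory
begin

lemma Hom_V_graph_subset: "Hom (TFrm T) A (V_graph T) \<subseteq> tpts A \<rightarrow>\<^sub>E Vset T"
  by (auto simp: TFrm_def)

lemma small_frame_points:
  assumes "T_frame T A"
  shows "small (elts T) (frame_points T A)"
  unfolding frame_points_def
  by (rule U.separation[OF U.small_graphs[OF T_frame_small[OF assms] Vset_small]])
    (intro image_mono Hom_V_graph_subset)

lemma fun_of_point:
  assumes "T_frame T A" "p \<in> Hom (TFrm T) A (V_graph T)"
  shows "fun_of (elts T) (tpts A) (graph_of (elts T) (tpts A) p) = p"
  using assms Hom_V_graph_subset
  by (intro U.fun_of_graph_of[OF T_frame_small Vset_small]) auto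

text \<open>On units the initial structure compares all evaluations, which is the pointwise order of
  homomorphisms.\<close>

lemma functor_eq_forgetful_pt:
  "functor_eq (opposite (TFrm T)) (comp_func (forgetful T) (pt T)) (hom_V T)"
proof -
  have "{(p, q). p \<in> frame_points T A \<and> q \<in> frame_points T A \<and>
         1 \<le> tstr (initial_graph T (frame_points T A) (tpts A) (eval_point T A))
               (Tunit T (frame_points T A) p) q} =
      {(graph_of (elts T) (tpts A) p, graph_of (elts T) (tpts A) q) | p q.
         p \<in> Hom (TFrm T) A (V_graph T) \<and> q \<in> Hom (TFrm T) A (V_graph T) \<and>
         (\<forall>x\<in>tpts A. val T (p x) \<le> val T (q x))}" (is "?L = ?R")
    if A: "T_frame T A" for A
  proof -
    have "?L = {(p, q). p \<in> frame_points T A \<and> q \<in> frame_points T A \<and>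
        (\<forall>x\<in>tpts A. eval_point T A x p \<le> eval_point T A x q)}"
      using le_initial_graph_Tunit_iff[OF small_frame_points[OF A]] by auto
    also have "\<dots> = ?R"
      by (fastforce simp: frame_points_def eval_point_def fun_of_point[OF A])
    finally show ?thesis .
  qed
  then show ?thesis
    by (auto simp: functor_eq_def opposite_def comp_func_def forgetful_def pt_def hom_V_def TFrm_def)
qed

lemma is_functor_pt:
  assumes "T_one T"
  shows "is_functor (opposite (TFrm T)) (TCat T) (pt T)"
proof -
  let ?E = "elts T" and ?V = "V_graph T" and ?F = "farr (pt T)"
  note cat = is_category_TFrm[OF assms]
  have V: "?V \<in> Ob (TFrm T)"
    by (simp add: TFrm_def T_frame_V_graph)
  have comp: "compose (tpts A) g f \<in> Hom (TFrm T) A C"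
    if "T_frame T A" "T_frame T B" "T_frame T C" "f \<in> Hom (TFrm T) A B" "g \<in> Hom (TFrm T) B C"
    for A B C f g
    using cat that unfolding is_category_def by (simp add: TFrm_def)
  \<comment> \<open>A homomorphism from \<open>A\<close> to \<open>B\<close> is an arrow from
    \<open>B\<close> to \<open>A\<close> in the opposite category, hence the order of the arguments
    of \<open>?F\<close>.\<close>
  have F: "?F B A f (graph_of ?E (tpts B) p) = graph_of ?E (tpts A) (compose (tpts A) p f)"
    if "T_frame T B" "p \<in> Hom (TFrm T) B ?V" for A B f p
    using that by (auto simp: pt_def hom_V_def frame_points_def fun_of_point) (simp add: TFrm_def)
  have F_ext: "?F B A f \<in> extensional (frame_points T B)" for A B f
    by (simp add: pt_def hom_V_def)
  have F_maps: "?F B A f \<in> frame_points T B \<rightarrow> frame_points T A"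
    if A: "T_frame T A" and B: "T_frame T B" and f: "f \<in> Hom (TFrm T) A B" for A B f
    using comp[OF A B T_frame_V_graph f] by (auto simp: frame_points_def F[OF B])
  have F_mor: "T_morphism T (fob (pt T) B) (fob (pt T) A) (?F B A f)"
    if A: "T_frame T A" and B: "T_frame T B" and f: "f \<in> Hom (TFrm T) A B" for A B f
  proof -
    \<comment> \<open>Evaluations are reindexed along \<open>f\<close>, as the criterion for
      morphisms between initial structures demands.\<close>
    have "eval_point T A x (?F B A f p) = eval_point T B (f x) p"
      if x: "x \<in> tpts A" and p: "p \<in> frame_points T B" for x p
      using p x comp[OF A B T_frame_V_graph f]
      by (auto simp: frame_points_def F[OF B] eval_point_def fun_of_point[OF A] fun_of_point[OF B]
          compose_def)
    moreover have "f \<in> tpts A \<rightarrow> tpts B"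
      using f by (auto simp: TFrm_def)
    ultimately have "T_morphism T (initial_graph T (frame_points T B) (tpts B) (eval_point T B))
        (initial_graph T (frame_points T A) (tpts A) (eval_point T A)) (?F B A f)"
      using A B f by (intro T_morphism_initial_graph small_frame_points F_maps)
    then show ?thesis
      by (simp add: pt_def)
  qed
  have pts: "tpts (fob (pt T) A) = frame_points T A" for A
    by (simp add: pt_def)
  have F_id: "?F A A (restrict id (tpts A)) = restrict id (frame_points T A)" if A: "T_frame T A" for A
  proof (rule extensionalityI[OF F_ext])
    fix q assume "q \<in> frame_points T A"
    then obtain p where p: "p \<in> Hom (TFrm T) A ?V" "q = graph_of ?E (tpts A) p"
      by (auto simp: frame_points_def)
    have "compose (tpts A) p (restrict id (tpts A)) = p"
      using p(1) by (auto simp: TFrm_def compose_def fun_eq_iff PiE_def extensional_def)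
    then show "?F A A (restrict id (tpts A)) q = restrict id (frame_points T A) q"
      using \<open>q \<in> frame_points T A\<close> by (simp add: p F[OF A p(1)])
  qed simp
  have F_comp: "?F C A (compose (tpts A) g f) =
      compose (frame_points T C) (?F B A f) (?F C B g)"
    if A: "T_frame T A" and B: "T_frame T B" and C: "T_frame T C"
      and f: "f \<in> Hom (TFrm T) A B" and g: "g \<in> Hom (TFrm T) B C" for A B C f g
  proof (rule extensionalityI[OF F_ext])
    fix q assume q: "q \<in> frame_points T C"
    then obtain p where p: "p \<in> Hom (TFrm T) C ?V" "q = graph_of ?E (tpts C) p"
      by (auto simp: frame_points_def)
    have "compose (tpts A) p (compose (tpts A) g f) = compose (tpts A) (compose (tpts B) p g) f"
      using f by (auto simp: TFrm_def compose_def fun_eq_iff)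
    then show "?F C A (compose (tpts A) g f) q = compose (frame_points T C) (?F B A f) (?F C B g) q"
      using q comp[OF B C T_frame_V_graph g p(1)]
      by (simp add: p(2) F[OF C p(1)] F[OF B] compose_eq)
  qed (simp add: compose_def)
  have "T_category T (fob (pt T) A)" if "T_frame T A" for A
    using that by (simp add: pt_def T_category_initial_graph small_frame_points)
  moreover have "?F B A f \<in> frame_points T B \<rightarrow>\<^sub>E frame_points T A"
    if "T_frame T A" "T_frame T B" "f \<in> Hom (TFrm T) A B" for A B f
    using F_maps[OF that] F_ext by (auto simp: PiE_def)
  moreover have "Ob (TFrm T) = {A. T_frame T A}" "ident (TFrm T) = (\<lambda>A. restrict id (tpts A))"
    "cmp (TFrm T) = (\<lambda>A B C g f. compose (tpts A) g f)"
    by (simp_all add: TFrm_def)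
  ultimately show ?thesis
    unfolding is_functor_def using is_category_opposite[OF cat] is_category_TCat F_mor F_id F_comp
    by (simp add: opposite_def TCat_def pts)
qed

end

theorem corollary2p11:
  fixes T :: "('u, 'v::comm_quantale) top_theory"
  assumes "strict_topological_theory T"
    and "T_one T"
  shows "V_graph T \<in> Ob (TFrm T) \<and>
         is_functor (opposite (TFrm T)) (Ord_cat (elts T)) (hom_V T) \<and>
         is_functor (TCat T) (Ord_cat (elts T)) (forgetful T) \<and>
         (\<exists>pt. lifts_to (opposite (TFrm T)) (TCat T) (forgetful T) (hom_V T) pt)"
proof -
  interpret strict_topological_theory T
    by (rule assms(1))
  note pt = is_functor_pt[OF assms(2)] and eq = functor_eq_forgetful_pt
  show ?thesis
    \<comment> \<open>\<open>hom_V\<close> is a functor because it agrees with the composite of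
      \<open>pt\<close> and the forgetful functor.\<close>
    using is_functor_functor_eq[OF is_functor_comp_func[OF pt is_functor_forgetful] eq]
      is_functor_forgetful pt eq
    by (auto simp: lifts_to_def TFrm_def T_frame_V_graph)
qed

end
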